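(* Let $0=N_0<N_1<\cdots<N_m=N$ be integers ($m\ge 1$), and let $[x_k]=(x_0,x_1,\ldots,x_N)$ be a zero-mean nonsingular Gaussian sequence of $\mathbb{R}^d$-valued random vectors with covariance function $C_{l_1,l_2}$, $l_1,l_2\in[0,N]$. Then $[x_k]$ is a waypoint CM sequence with respect to $N_0,\ldots,N_m$ (as defined in the context) if and only if there exist $d\times d$ real matrices $G_{k,k-1}$, $G_{k,N_n}$ (for $n\in[1,m]$, $k\in[N_{n-1}+1,N_n-1]$) and $G_{N_n,N_{n-1}}$ (for $n\in[1,m]$) such that, for all $n\in[1,m]$ and all $k\in[N_{n-1}+1,N_n-1]$, $$x_k=G_{k,k-1}x_{k-1}+G_{k,N_n}x_{N_n}+e_k,$$ and, for all $n\in[1,m]$, $$x_{N_n}=G_{N_n,N_{n-1}}x_{N_{n-1}}+e_{N_n},$$ where $[e_k]_1^N=(e_1,\ldots,e_N)$ is a zero-mean white Gaussian sequence with nonsingular covariances $G_k=\mathrm{Cov}(e_k)$, uncorrelated with $x_0$, and $x_0$ has nonsingular covariance $G_0$.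
   Context: Notation: for integers $i\le j$, $[i,j]=\{i,i+1,\ldots,j\}$ (empty if $i>j$); $[x_k]_i^j=\{x_k: k\in[i,j]\}$; $[x_k]=[x_k]_0^N$. $F(\cdot\mid\cdot)$ denotes a conditional cumulative distribution function; equalities of conditional distributions are understood almost surely. A sequence $[x_k]$ is Gaussian if $(x_0,\ldots,x_N)$ is jointly Gaussian. It is zero-mean nonsingular Gaussian if, in addition, all means are zero and the covariance matrix of the stacked vector $(x_0',\ldots,x_N')'$ is nonsingular. Its covariance function is $C_{l_1,l_2}=\mathrm{Cov}(x_{l_1},x_{l_2})$. A zero-mean white Gaussian sequence is a jointly Gaussian zero-mean sequence whose terms at different times are uncorrelated. In the representation, "uncorrelated with $x_0$" is for the jointly Gaussian family $(x_0,e_1,\ldots,e_N)$. Definition (waypoint CM sequence). Given $0=N_0<N_1<\cdots<N_m=N$, a stochastic sequence $[x_k]$ is called a waypoint CM sequence (with respect to $N_0,\ldots,N_m$) if: (i) for all $n\in[1,m]$ and all $j,k$ with $N_{n-1}\le j<k<N_n$, $$F(x_k\mid [x_i]_0^j,\,x_{N_n})=F(x_k\mid x_j,\,x_{N_n});$$ (ii) for all $n\in[1,m]$ and all $h$ with $0\le h<n$, $$F(x_{N_n}\mid [x_i]_0^{N_h})=F(x_{N_n}\mid x_{N_h}).$$ *)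

theory Defs
  imports "HOL-Probability.Probability"
begin

section \<open>Gaussian families of random vectors\<close>

text \<open>A normal law on the real line; variance zero gives a point mass.\<close>

definition normal_law :: "real \<Rightarrow> real \<Rightarrow> real measure" where
  "normal_law \<mu> \<sigma> =
     (if \<sigma> = 0 then return borel \<mu> else density lborel (normal_density \<mu> \<sigma>))"

text \<open>Joint Gaussianity: every linear functional of the stacked vector is normally
  distributed, possibly degenerate.\<close>

definition jointly_gaussian ::
    "'a measure \<Rightarrow> 'i set \<Rightarrow> ('i \<Rightarrow> 'a \<Rightarrow> real ^ 'd) \<Rightarrow> bool" where
  "jointly_gaussian M I X \<longleftrightarrow>
     finite I \<and> (\<forall>i\<in>I. X i \<in> borel_measurable M) \<and>
     (\<forall>a :: 'i \<Rightarrow> real ^ 'd. \<exists>\<mu> \<sigma>. 0 \<le> \<sigma> \<and>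
        distr M borel (\<lambda>\<omega>. \<Sum>i\<in>I. a i \<bullet> X i \<omega>) = normal_law \<mu> \<sigma>)"

definition zero_mean :: "'a measure \<Rightarrow> 'i set \<Rightarrow> ('i \<Rightarrow> 'a \<Rightarrow> real ^ 'd) \<Rightarrow> bool" where
  "zero_mean M I X \<longleftrightarrow> (\<forall>i\<in>I. (\<integral>\<omega>. X i \<omega> \<partial>M) = 0)"

definition Cov :: "'a measure \<Rightarrow> ('a \<Rightarrow> real ^ 'd) \<Rightarrow> ('a \<Rightarrow> real ^ 'd) \<Rightarrow> real ^ 'd ^ 'd" where
  "Cov M X Y = (\<chi> i j. \<integral>\<omega>. (X \<omega> $ i - (\<integral>\<omega>'. X \<omega>' $ i \<partial>M)) * (Y \<omega> $ j - (\<integral>\<omega>'. Y \<omega>' $ j \<partial>M)) \<partial>M)"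

text \<open>A family of \<open>d \<times> d\<close> matrices indexed by pairs from \<open>{0..N}\<close> stands for a square matrix
  of size \<open>(N + 1) d\<close>, given by its blocks.  As in the library's \<open>invertible\<close>, nonsingular
  means having a two-sided inverse, with the matrix product computed blockwise.\<close>

definition block_nonsingular :: "nat \<Rightarrow> (nat \<Rightarrow> nat \<Rightarrow> real ^ 'd ^ 'd) \<Rightarrow> bool" where
  "block_nonsingular N A \<longleftrightarrow>
     (\<exists>B :: nat \<Rightarrow> nat \<Rightarrow> real ^ 'd ^ 'd. \<forall>k\<in>{0..N}. \<forall>l\<in>{0..N}.
        (\<Sum>j=0..N. A k j ** B j l) = (if k = l then mat 1 else 0) \<and>
        (\<Sum>j=0..N. B k j ** A j l) = (if k = l then mat 1 else 0))"

definition zero_mean_nonsingular_gaussian ::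
    "'a measure \<Rightarrow> nat \<Rightarrow> (nat \<Rightarrow> 'a \<Rightarrow> real ^ 'd) \<Rightarrow> bool" where
  "zero_mean_nonsingular_gaussian M N x \<longleftrightarrow>
     jointly_gaussian M {0..N} x \<and> zero_mean M {0..N} x \<and>
     block_nonsingular N (\<lambda>k l. Cov M (x k) (x l))"

definition zero_mean_white_gaussian ::
    "'a measure \<Rightarrow> 'i set \<Rightarrow> ('i \<Rightarrow> 'a \<Rightarrow> real ^ 'd) \<Rightarrow> bool" where
  "zero_mean_white_gaussian M I e \<longleftrightarrow>
     jointly_gaussian M I e \<and> zero_mean M I e \<and>
     (\<forall>j\<in>I. \<forall>k\<in>I. j \<noteq> k \<longrightarrow> Cov M (e j) (e k) = 0)"


section \<open>Conditional distribution functions and waypoint CM sequences\<close>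

text \<open>The \<open>\<sigma>\<close>-algebra on the sample space generated by the variables \<open>x i\<close>, \<open>i \<in> I\<close>.\<close>

definition generated_by :: "'a measure \<Rightarrow> 'i set \<Rightarrow> ('i \<Rightarrow> 'a \<Rightarrow> real ^ 'd) \<Rightarrow> 'a measure" where
  "generated_by M I x =
     vimage_algebra (space M) (\<lambda>\<omega>. \<lambda>i\<in>I. x i \<omega>) (\<Pi>\<^sub>M i\<in>I. borel)"

lemma subalgebra_generated_by:
  assumes "\<And>i. i \<in> I \<Longrightarrow> x i \<in> borel_measurable M"
  shows "subalgebra M (generated_by M I x)"
proof -
  have "(\<lambda>\<omega>. \<lambda>i\<in>I. x i \<omega>) \<in> M \<rightarrow>\<^sub>M (\<Pi>\<^sub>M i\<in>I. borel)"
    using assms by (intro measurable_restrict) auto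
  then have "sets (generated_by M I x) \<subseteq> sets M"
    unfolding generated_by_def by (intro sets_image_in_sets) auto
  then show ?thesis
    by (simp add: subalgebra_def generated_by_def)
qed

text \<open>\<open>cond_cdf M y I x c\<close> is a version of the conditional distribution function of \<open>y\<close> given
  \<open>x i\<close>, \<open>i \<in> I\<close>, at the point \<open>c\<close>.  The order on vectors is componentwise.\<close>

definition cond_cdf ::
    "'a measure \<Rightarrow> ('a \<Rightarrow> real ^ 'd) \<Rightarrow> 'i set \<Rightarrow> ('i \<Rightarrow> 'a \<Rightarrow> real ^ 'd) \<Rightarrow> real ^ 'd \<Rightarrow> 'a \<Rightarrow> real" where
  "cond_cdf M y I x c =
     real_cond_exp M (generated_by M I x) (indicator {\<omega> \<in> space M. y \<omega> \<le> c})"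

text \<open>The waypoints \<open>N\<^sub>0 < \<dots> < N\<^sub>m\<close> are the values \<open>T 0, \<dots>, T m\<close>.\<close>

definition waypoint_CM ::
    "'a measure \<Rightarrow> nat \<Rightarrow> (nat \<Rightarrow> nat) \<Rightarrow> (nat \<Rightarrow> 'a \<Rightarrow> real ^ 'd) \<Rightarrow> bool" where
  "waypoint_CM M m T x \<longleftrightarrow>
     (\<forall>n\<in>{1..m}. \<forall>j k. T (n - 1) \<le> j \<and> j < k \<and> k < T n \<longrightarrow>
        (\<forall>c. AE \<omega> in M.
           cond_cdf M (x k) ({0..j} \<union> {T n}) x c \<omega> = cond_cdf M (x k) {j, T n} x c \<omega>)) \<and>
     (\<forall>n\<in>{1..m}. \<forall>h<n.
        (\<forall>c. AE \<omega> in M.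
           cond_cdf M (x (T n)) {0..T h} x c \<omega> = cond_cdf M (x (T n)) {T h} x c \<omega>))"

end

theory Submission
  imports Defs
begin

text \<open>For jointly Gaussian variables, uncorrelated means independent, and conditional distribution
  functions can be compared with linear regressions: if \<open>J \<subseteq> I\<close>, the conditional law of \<open>y\<close> given
  \<open>x i\<close> (\<open>i \<in> I\<close>) depends only on the \<open>x j\<close> (\<open>j \<in> J\<close>) iff the residual of the regression of \<open>y\<close> on
  the \<open>x j\<close> is uncorrelated with every \<open>x i\<close>. The waypoint CM property with \<open>j = k - 1\<close> and
  \<open>h = n - 1\<close> therefore makes the regression residuals \<open>e k\<close> uncorrelated with the past of \<open>k\<close>, when
  each waypoint is ordered before the section it closes; this gives whiteness. Conversely, iterating the
  equations writes \<open>x k\<close> as a linear function of \<open>x j\<close> and the next waypoint plus later innovations,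
  and these are uncorrelated with the past of \<open>j\<close>.

  Independence is obtained without multivariate characteristic functions: a one-dimensional uniqueness
  theorem is applied to one coordinate at a time, for integrals weighted by a fixed integrable function.\<close>

section \<open>Trigonometric integrals determine weighted laws\<close>

text \<open>Conditional distribution functions are compared through one signed weight. For an event
  A of the larger sigma-algebra F, let g be the indicator of A minus its conditional probability
  given the smaller G. Since conditional expectation is self-adjoint, equality of the two
  conditional distribution functions of y says that g integrates to 0 against every event of
  sigma(y). The weight is fixed before y is looked at, so y can be tested by any convenient class:
  orthants for the definition, cosines with a phase for the Gaussian computation. This is why
  uniqueness is stated for signed weights.

  Two obstacles shape the rest. Linear functionals are unbounded while uniqueness speaks of events;
  the passage goes through a vanishing conditional expectation. And the model equations hold only
  almost surely, so functionals and spans are taken up to null sets. In the converse, x 0 counts as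
  the innovation at time 0; the resulting orthogonal family spans all x k, and orthogonality becomes
  disjointness of two index sets.\<close>

lemma integrable_mult_bounded:
  fixes f g :: "'a \<Rightarrow> real"
  assumes "integrable M f" "g \<in> borel_measurable M" "AE \<omega> in M. \<bar>g \<omega>\<bar> \<le> 1"
  shows "integrable M (\<lambda>\<omega>. f \<omega> * g \<omega>)" "integrable M (\<lambda>\<omega>. g \<omega> * f \<omega>)"
proof -
  have "AE \<omega> in M. norm (f \<omega> * g \<omega>) \<le> norm (f \<omega>)"
    using assms(3) by eventually_elim (simp add: abs_mult mult_left_le)
  then show "integrable M (\<lambda>\<omega>. f \<omega> * g \<omega>)"
    using assms by (intro Bochner_Integration.integrable_bound[OF assms(1)]) auto
  then show "integrable M (\<lambda>\<omega>. g \<omega> * f \<omega>)" by (simp add: mult.commute)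
qed

text \<open>A nonnegative weight \<open>h\<close> of mass \<open>p\<close> is normalised to a
  probability density, and \<open>D\<close> is the law of \<open>Z\<close> under it. Weighted cosine
  and sine integrals thereby become the real and imaginary parts of a characteristic
  function.\<close>

lemma density_pushforward:
  fixes h Z :: "'a \<Rightarrow> real"
  assumes h: "integrable M h" "\<And>\<omega>. 0 \<le> h \<omega>" and p: "0 < p" "(\<integral>\<omega>. h \<omega> \<partial>M) = p"
    and Z [measurable]: "Z \<in> borel_measurable M"
  defines "D \<equiv> distr (density M (\<lambda>\<omega>. ennreal (h \<omega> / p))) borel Z"
  shows "real_distribution D"
    and "Re (char D t) = (\<integral>\<omega>. h \<omega> * cos (t * Z \<omega>) \<partial>M) / p"
    and "Im (char D t) = (\<integral>\<omega>. h \<omega> * sin (t * Z \<omega>) \<partial>M) / p"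
    and "B \<in> sets borel \<Longrightarrow> measure D B = (\<integral>\<omega>. h \<omega> * indicator B (Z \<omega>) \<partial>M) / p"
proof -
  have [measurable]: "h \<in> borel_measurable M" using h by auto
  let ?E = "density M (\<lambda>\<omega>. ennreal (h \<omega> / p))"
  have "emeasure ?E (space ?E) = (\<integral>\<^sup>+\<omega>. ennreal (h \<omega> / p) \<partial>M)"
    by (subst emeasure_density) (auto intro!: nn_integral_cong simp: indicator_def)
  also have "\<dots> = ennreal (\<integral>\<omega>. h \<omega> / p \<partial>M)"
    using h p by (intro nn_integral_eq_integral) auto
  also have "\<dots> = 1" using p by simp
  finally have E: "prob_space ?E" by (rule prob_spaceI)
  interpret E: prob_space ?E by (rule E)
  have D: "prob_space D" unfolding D_def by (rule E.prob_space_distr) simp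
  show "real_distribution D"
    unfolding real_distribution_def real_distribution_axioms_def using D by (simp add: D_def)
  have eq: "char D t = (CLINT \<omega>|M. (h \<omega> / p) *\<^sub>R iexp (t * Z \<omega>))" for t
    unfolding char_def D_def using h p
    by (subst integral_distr, simp, simp, subst integral_density) (auto intro!: AE_I2)
  have int: "complex_integrable M (\<lambda>\<omega>. (h \<omega> / p) *\<^sub>R iexp (t * Z \<omega>))"
    using p by (intro Bochner_Integration.integrable_bound[OF integrable_divide[OF h(1), of p]])
       (auto simp: norm_mult)
  have "Re (char D t) = (\<integral>\<omega>. Re ((h \<omega> / p) *\<^sub>R iexp (t * Z \<omega>)) \<partial>M)"
    unfolding eq using int by (rule integral_Re[symmetric])
  also have "\<dots> = (\<integral>\<omega>. h \<omega> * cos (t * Z \<omega>) / p \<partial>M)"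
    by (intro Bochner_Integration.integral_cong) (auto simp: Re_exp)
  finally show "Re (char D t) = (\<integral>\<omega>. h \<omega> * cos (t * Z \<omega>) \<partial>M) / p" by simp
  have "Im (char D t) = (\<integral>\<omega>. Im ((h \<omega> / p) *\<^sub>R iexp (t * Z \<omega>)) \<partial>M)"
    unfolding eq using int by (rule integral_Im[symmetric])
  also have "\<dots> = (\<integral>\<omega>. h \<omega> * sin (t * Z \<omega>) / p \<partial>M)"
    by (intro Bochner_Integration.integral_cong) (auto simp: Im_exp)
  finally show "Im (char D t) = (\<integral>\<omega>. h \<omega> * sin (t * Z \<omega>) \<partial>M) / p" by simp
  assume B [measurable]: "B \<in> sets borel"
  interpret D: prob_space D by (rule D)
  have "measure D B = (\<integral>x. indicator B x \<partial>D)" by (simp add: D_def)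
  also have "\<dots> = (\<integral>\<omega>. (h \<omega> / p) *\<^sub>R indicator B (Z \<omega>) \<partial>M)"
    unfolding D_def using h p
    by (subst integral_distr, simp, simp, subst integral_density) (auto intro!: AE_I2)
  finally show "measure D B = (\<integral>\<omega>. h \<omega> * indicator B (Z \<omega>) \<partial>M) / p" by simp
qed

text \<open>Levy's uniqueness theorem, applied to the normalised positive and negative parts of \<open>f\<close>.\<close>

lemma integral_indicator_eq_0_if_trig_integrals_eq_0:
  fixes f Z :: "'a \<Rightarrow> real"
  assumes f: "integrable M f" and Z [measurable]: "Z \<in> borel_measurable M"
    and cos0: "\<And>s. (\<integral>\<omega>. f \<omega> * cos (s * Z \<omega>) \<partial>M) = 0"
    and sin0: "\<And>s. (\<integral>\<omega>. f \<omega> * sin (s * Z \<omega>) \<partial>M) = 0"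
    and B [measurable]: "B \<in> sets borel"
  shows "(\<integral>\<omega>. f \<omega> * indicator B (Z \<omega>) \<partial>M) = 0"
proof -
  define u v where "u = (\<lambda>\<omega>. max (f \<omega>) 0)" and "v = (\<lambda>\<omega>. max (- f \<omega>) 0)"
  have fm [measurable]: "f \<in> borel_measurable M" using f by auto
  have f_eq: "f \<omega> = u \<omega> - v \<omega>" for \<omega> by (auto simp: u_def v_def)
  have uv: "integrable M u" "integrable M v" "\<And>\<omega>. 0 \<le> u \<omega>" "\<And>\<omega>. 0 \<le> v \<omega>"
    using f by (auto simp: u_def v_def)
  have split: "(\<integral>\<omega>. f \<omega> * g \<omega> \<partial>M) = (\<integral>\<omega>. u \<omega> * g \<omega> \<partial>M) - (\<integral>\<omega>. v \<omega> * g \<omega> \<partial>M)"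
    if "g \<in> borel_measurable M" "\<And>\<omega>. \<bar>g \<omega>\<bar> \<le> 1" for g :: "'a \<Rightarrow> real"
    unfolding f_eq left_diff_distrib
    using that uv by (intro Bochner_Integration.integral_diff integrable_mult_bounded) auto
  define p where "p = (\<integral>\<omega>. u \<omega> \<partial>M)"
  \<comment> \<open>The cosine hypothesis at frequency 0 says that \<open>f\<close> has total
    integral 0, so both parts have the same mass and one constant \<open>p\<close> normalises
    both.\<close>
  have pv: "(\<integral>\<omega>. v \<omega> \<partial>M) = p" using cos0[of 0] split[of "\<lambda>_. 1"] by (simp add: p_def)
  have "p \<ge> 0" unfolding p_def using uv by simp
  show ?thesis
  proof (cases "p = 0")
    \<comment> \<open>With mass 0 there is no law to form; both parts, hence \<open>f\<close>,
      vanish almost everywhere.\<close>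
    case True
    have "AE \<omega> in M. u \<omega> = 0" "AE \<omega> in M. v \<omega> = 0"
      using integral_nonneg_eq_0_iff_AE[of M u] integral_nonneg_eq_0_iff_AE[of M v] uv pv True p_def
      by auto
    then have "AE \<omega> in M. f \<omega> * indicator B (Z \<omega>) = 0"
      by eventually_elim (simp add: f_eq)
    then show ?thesis by (rule integral_eq_zero_AE)
  next
    case False
    with \<open>p \<ge> 0\<close> have p: "p > 0" by simp
    let ?D = "\<lambda>h. distr (density M (\<lambda>\<omega>. ennreal (h \<omega> / p))) borel Z"
    note U = density_pushforward[OF uv(1,3) p p_def[symmetric] Z]
    note V = density_pushforward[OF uv(2,4) p pv Z]
    have "char (?D u) = char (?D v)"
    proof (intro ext complex_eqI)
      fix t
      show "Re (char (?D u) t) = Re (char (?D v) t)"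
        using split[of "\<lambda>\<omega>. cos (t * Z \<omega>)"] cos0[of t] U(2)[of t] V(2)[of t] by simp
      show "Im (char (?D u) t) = Im (char (?D v) t)"
        using split[of "\<lambda>\<omega>. sin (t * Z \<omega>)"] sin0[of t] U(3)[of t] V(3)[of t] by simp
    qed
    then have "?D u = ?D v" by (rule Levy_uniqueness[OF U(1) V(1)])
    with U(4)[OF B] V(4)[OF B] p
    have "(\<integral>\<omega>. u \<omega> * indicator B (Z \<omega>) \<partial>M) = (\<integral>\<omega>. v \<omega> * indicator B (Z \<omega>) \<partial>M)" by simp
    then show ?thesis using split[of "\<lambda>\<omega>. indicator B (Z \<omega>)"] by (simp add: indicator_def)
  qed
qed

text \<open>The free phase \<open>\<theta>\<close> replaces the sine moments; the induction absorbs one indicator into \<open>f\<close>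
  at a time.\<close>

lemma integral_prod_indicator_eq_0_if_trig_integrals_eq_0:
  fixes f :: "'a \<Rightarrow> real" and Z :: "'k \<Rightarrow> 'a \<Rightarrow> real"
  assumes "finite K" and "integrable M f" and "\<And>k. k \<in> K \<Longrightarrow> Z k \<in> borel_measurable M"
    and "\<And>s \<theta>. (\<integral>\<omega>. f \<omega> * cos ((\<Sum>k\<in>K. s k * Z k \<omega>) + \<theta>) \<partial>M) = 0"
    and "\<And>k. k \<in> K \<Longrightarrow> B k \<in> sets borel"
  shows "(\<integral>\<omega>. f \<omega> * (\<Prod>k\<in>K. indicator (B k) (Z k \<omega>)) \<partial>M) = 0"
  using assms
proof (induction K arbitrary: f rule: finite_induct)
  case empty
  from empty(3)[of undefined 0] show ?case by simp
next
  case (insert l K)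
  have [measurable]: "Z l \<in> borel_measurable M" "\<And>k. k \<in> K \<Longrightarrow> Z k \<in> borel_measurable M"
    "f \<in> borel_measurable M" "B l \<in> sets borel"
    using insert.prems by auto
  let ?S = "\<lambda>s \<theta> \<omega>. (\<Sum>k\<in>K. s k * Z k \<omega>) + \<theta>"
  let ?f' = "\<lambda>\<omega>. f \<omega> * indicator (B l) (Z l \<omega>)"
  have trig: "(\<integral>\<omega>. f \<omega> * cos (r * Z l \<omega> + ?S s \<theta> \<omega>) \<partial>M) = 0" for r s \<theta>
  proof -
    have "(\<Sum>k\<in>K. (s(l := r)) k * Z k \<omega>) = (\<Sum>k\<in>K. s k * Z k \<omega>)" for \<omega>
      using insert.hyps by (intro sum.cong) auto
    with insert.prems(3)[of "s(l := r)" \<theta>] insert.hyps show ?thesis by (simp add: add.assoc)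
  qed
  have int: "integrable M (\<lambda>\<omega>. f \<omega> * cos (r * Z l \<omega> + ?S s \<theta> \<omega>))" for r s \<theta>
    by (intro integrable_mult_bounded insert.prems) auto
  have cos_cos: "cos y * cos b = (cos (b + y) + cos (- b + y)) / 2" for y b :: real
    by (simp add: cos_add cos_diff field_simps)
  have sin_cos: "cos y * sin b = (sin (b + y) - sin (- b + y)) / 2" for y b :: real
    by (simp add: sin_add sin_diff field_simps)
  \<comment> \<open>Moving the phase by a quarter turn writes this product as a difference of
    cosines, so sine moments stay inside the family of integrals that \<open>trig\<close>
    covers.\<close>
  have cos_sin: "cos (a + \<theta>) * sin b
      = (cos (b + (a + (\<theta> - pi / 2))) - cos (- b + (a + (\<theta> - pi / 2)))) / 2" for a b \<theta> :: real
  proof -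
    have "cos (z + (a + (\<theta> - pi / 2))) = sin (z + (a + \<theta>))" for z
      using cos_diff[of "z + (a + \<theta>)" "pi / 2"] by (simp add: algebra_simps)
    then show ?thesis by (simp only: sin_cos)
  qed
  have "(\<integral>\<omega>. ?f' \<omega> * cos (?S s \<theta> \<omega>) \<partial>M) = 0" for s \<theta>
  proof -
    have "(\<integral>\<omega>. (f \<omega> * cos (?S s \<theta> \<omega>)) * indicator (B l) (Z l \<omega>) \<partial>M) = 0"
    proof (rule integral_indicator_eq_0_if_trig_integrals_eq_0)
      show "integrable M (\<lambda>\<omega>. f \<omega> * cos (?S s \<theta> \<omega>))"
        by (intro integrable_mult_bounded insert.prems) auto
      fix r
      have "(\<integral>\<omega>. f \<omega> * cos (?S s \<theta> \<omega>) * cos (r * Z l \<omega>) \<partial>M)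
        = (\<integral>\<omega>. (f \<omega> * cos (r * Z l \<omega> + ?S s \<theta> \<omega>) + f \<omega> * cos ((- r) * Z l \<omega> + ?S s \<theta> \<omega>)) / 2 \<partial>M)"
        unfolding mult.assoc cos_cos by (intro Bochner_Integration.integral_cong) (simp_all add: algebra_simps)
      also have "\<dots> = 0" using trig[of r s \<theta>] trig[of "-r" s \<theta>] int[of r s \<theta>] int[of "-r" s \<theta>]
        by simp
      finally show "(\<integral>\<omega>. f \<omega> * cos (?S s \<theta> \<omega>) * cos (r * Z l \<omega>) \<partial>M) = 0" .
      have "(\<integral>\<omega>. f \<omega> * cos (?S s \<theta> \<omega>) * sin (r * Z l \<omega>) \<partial>M)
        = (\<integral>\<omega>. (f \<omega> * cos (r * Z l \<omega> + ?S s (\<theta> - pi / 2) \<omega>) - f \<omega> * cos ((- r) * Z l \<omega> + ?S s (\<theta> - pi / 2) \<omega>)) / 2 \<partial>M)"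
        unfolding mult.assoc cos_sin by (intro Bochner_Integration.integral_cong) (simp_all add: algebra_simps)
      also have "\<dots> = 0" using trig[of r s "\<theta> - pi / 2"] trig[of "-r" s "\<theta> - pi / 2"]
          int[of r s "\<theta> - pi / 2"] int[of "-r" s "\<theta> - pi / 2"]
        by simp
      finally show "(\<integral>\<omega>. f \<omega> * cos (?S s \<theta> \<omega>) * sin (r * Z l \<omega>) \<partial>M) = 0" .
    qed auto
    then show ?thesis by (simp add: mult_ac)
  qed
  moreover have "integrable M ?f'"
    by (intro integrable_mult_bounded insert.prems) (auto simp: indicator_def)
  ultimately have "(\<integral>\<omega>. ?f' \<omega> * (\<Prod>k\<in>K. indicator (B k) (Z k \<omega>)) \<partial>M) = 0"
    using insert.prems by (intro insert.IH) auto
  then show ?case using insert.hyps by (simp add: mult_ac)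
qed


section \<open>Signed weights on the sigma-algebra of a family of random vectors\<close>

lemma measurable_generated_by:
  assumes "i \<in> I"
  shows "x i \<in> borel_measurable (generated_by M I x)"
proof -
  have "(\<lambda>\<omega>. \<lambda>i\<in>I. x i \<omega>) \<in> generated_by M I x \<rightarrow>\<^sub>M (\<Pi>\<^sub>M i\<in>I. borel)"
    unfolding generated_by_def
    by (intro measurable_vimage_algebra1) (auto simp: space_PiM)
  from measurable_compose[OF this measurable_component_singleton[OF assms]] assms
  show ?thesis by simp
qed

lemma sets_generated_by_subset:
  assumes "space N = space M" "\<And>i. i \<in> I \<Longrightarrow> x i \<in> borel_measurable N"
  shows "sets (generated_by M I x) \<subseteq> sets N"
  unfolding generated_by_def
  by (rule sets_image_in_sets) (use assms in \<open>auto intro!: measurable_restrict\<close>)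

lemma space_generated_by [simp]: "space (generated_by M I x) = space M"
  by (simp add: generated_by_def)

text \<open>Dynkin's argument for a signed weight: total integral 0 gives closure under complements,
  and countable additivity of the integral gives closure under disjoint unions.\<close>

lemma integral_indicator_sigma_sets_eq_0:
  fixes f :: "'a \<Rightarrow> real"
  assumes "Int_stable G" "G \<subseteq> sets M" and f: "integrable M f" "(\<integral>\<omega>. f \<omega> \<partial>M) = 0"
    and G: "\<And>A. A \<in> G \<Longrightarrow> (\<integral>\<omega>. f \<omega> * indicator A \<omega> \<partial>M) = 0"
    and A: "A \<in> sigma_sets (space M) G"
  shows "(\<integral>\<omega>. f \<omega> * indicator A \<omega> \<partial>M) = 0"
proof -
  have sub: "sigma_sets (space M) G \<subseteq> sets M"
    using assms(2) by (rule sets.sigma_sets_subset)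
  have int: "integrable M (\<lambda>\<omega>. f \<omega> * indicator A \<omega>)" if "A \<in> sigma_sets (space M) G" for A
    using that sub by (intro integrable_mult_bounded f) (auto simp: indicator_def)
  have "G \<subseteq> Pow (space M)" using assms(2) sets.sets_into_space by blast
  from \<open>Int_stable G\<close> this A show ?thesis
  proof (induction rule: sigma_sets_induct_disjoint)
    case (basic A)
    then show ?case by (rule G)
  next
    case empty
    show ?case by simp
  next
    case (compl A)
    have "(\<integral>\<omega>. f \<omega> * indicator (space M - A) \<omega> \<partial>M) = (\<integral>\<omega>. f \<omega> - f \<omega> * indicator A \<omega> \<partial>M)"
      by (intro Bochner_Integration.integral_cong) (auto simp: indicator_def)
    also have "\<dots> = 0" using compl int[of A] f by simp
    finally show ?case .
  next
    case (union A)
    have A: "A i \<in> sets M" for i using union sub by auto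
    have si: "set_integrable M (\<Union>i. A i) f"
      using integrable_mult_indicator[OF sets.countable_UN[of A UNIV M] f(1)] A
      by (auto simp: set_integrable_def)
    have "(LINT \<omega>:(\<Union>i. A i)|M. f \<omega>) = (\<Sum>i. LINT \<omega>:A i|M. f \<omega>)"
      by (rule lebesgue_integral_countable_add[OF A _ si])
        (use union.hyps in \<open>auto simp: disjoint_family_on_def\<close>)
    then show ?case using union.IH by (simp add: set_lebesgue_integral_def mult.commute)
  qed
qed

text \<open>The vectors are cut into real coordinates. Boxes in these coordinates are closed under
  intersection, their indicators are products of one-dimensional indicators, and they generate the
  sigma-algebra because a condition on one coordinate is a box whose other sides are the whole
  line.\<close>

lemma integral_indicator_generated_by_eq_0:
  fixes f :: "'a \<Rightarrow> real" and x :: "'i \<Rightarrow> 'a \<Rightarrow> real ^ 'd"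
  assumes I: "finite I" and f: "integrable M f"
    and x: "\<And>i. i \<in> I \<Longrightarrow> x i \<in> borel_measurable M"
    and trig: "\<And>a \<theta>. (\<integral>\<omega>. f \<omega> * cos ((\<Sum>i\<in>I. a i \<bullet> x i \<omega>) + \<theta>) \<partial>M) = 0"
    and A: "A \<in> sets (generated_by M I x)"
  shows "(\<integral>\<omega>. f \<omega> * indicator A \<omega> \<partial>M) = 0"
proof -
  define K where "K = I \<times> (UNIV :: 'd set)"
  define Z where "Z = (\<lambda>k \<omega>. x (fst k) \<omega> $ snd k)"
  define box where "box = (\<lambda>B. {\<omega> \<in> space M. \<forall>k\<in>K. Z k \<omega> \<in> B k})"
  define G where "G = box ` {B. \<forall>k\<in>K. B k \<in> sets borel}"
  have K: "finite K" using I by (simp add: K_def)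
  have Z [measurable]: "Z k \<in> borel_measurable M" if "k \<in> K" for k
  proof -
    have "x (fst k) \<in> borel_measurable M" using that by (intro x) (auto simp: K_def)
    then show ?thesis unfolding Z_def by (rule borel_measurable_continuous_on[rotated]) (intro continuous_intros)
  qed
  have stable: "Int_stable G"
    unfolding G_def
  proof (rule Int_stableI_image)
    fix B C :: "'i \<times> 'd \<Rightarrow> real set"
    assume "B \<in> {B. \<forall>k\<in>K. B k \<in> sets borel}" "C \<in> {B. \<forall>k\<in>K. B k \<in> sets borel}"
    then show "\<exists>D\<in>{B. \<forall>k\<in>K. B k \<in> sets borel}. box B \<inter> box C = box D"
      by (intro bexI[of _ "\<lambda>k. B k \<inter> C k"]) (auto simp: box_def)
  qed
  have G_sets: "G \<subseteq> sets M"
    unfolding G_def box_def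
  proof safe
    fix B :: "'i \<times> 'd \<Rightarrow> real set" assume B: "\<forall>k\<in>K. B k \<in> sets borel"
    have "{\<omega> \<in> space M. Z k \<omega> \<in> B k} \<in> sets M" if "k \<in> K" for k
      using measurable_sets[OF Z[OF that], of "B k"] B that by (simp add: vimage_def Int_def conj_commute)
    then show "{\<omega> \<in> space M. \<forall>k\<in>K. Z k \<omega> \<in> B k} \<in> sets M"
      using K by (rule sets.sets_Collect_finite_All)
  qed
  have f0: "(\<integral>\<omega>. f \<omega> \<partial>M) = 0"
    using trig[of "\<lambda>_. 0" 0] by simp
  have G0: "(\<integral>\<omega>. f \<omega> * indicator A \<omega> \<partial>M) = 0" if "A \<in> G" for A
  proof -
    from that obtain B where B: "\<And>k. k \<in> K \<Longrightarrow> B k \<in> sets borel" and A: "A = box B"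
      by (auto simp: G_def)
    have int0: "(\<integral>\<omega>. f \<omega> * (\<Prod>k\<in>K. indicator (B k) (Z k \<omega>)) \<partial>M) = 0"
    proof (rule integral_prod_indicator_eq_0_if_trig_integrals_eq_0[OF K f Z _ B])
      fix s \<theta>
      have "(\<Sum>k\<in>K. s k * Z k \<omega>) = (\<Sum>i\<in>I. (\<chi> l. s (i, l)) \<bullet> x i \<omega>)" for \<omega>
        by (simp add: K_def Z_def inner_vec_def sum.cartesian_product case_prod_beta')
      with trig[of "\<lambda>i. \<chi> l. s (i, l)" \<theta>]
      show "(\<integral>\<omega>. f \<omega> * cos ((\<Sum>k\<in>K. s k * Z k \<omega>) + \<theta>) \<partial>M) = 0" by simp
    qed
    have eq: "(\<Prod>k\<in>K. indicator (B k) (Z k \<omega>)) = (indicator A \<omega> :: real)"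
      if "\<omega> \<in> space M" for \<omega>
    proof (cases "\<omega> \<in> A")
      case True
      then show ?thesis by (intro prod.neutral[THEN trans]) (auto simp: A box_def)
    next
      case False
      with that obtain k where "k \<in> K" "Z k \<omega> \<notin> B k" by (auto simp: A box_def)
      with K False show ?thesis by (intro prod_zero[THEN trans]) (auto intro!: bexI[of _ k])
    qed
    have "(\<integral>\<omega>. f \<omega> * (\<Prod>k\<in>K. indicator (B k) (Z k \<omega>)) \<partial>M)
        = (\<integral>\<omega>. f \<omega> * indicator A \<omega> \<partial>M)"
      by (intro Bochner_Integration.integral_cong refl) (simp add: eq)
    with int0 show ?thesis by simp
  qed
  have "A \<in> sigma_sets (space M) G"
  proof -
    let ?N = "sigma (space M) G"
    have Pow: "G \<subseteq> Pow (space M)" by (auto simp: G_def box_def)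
    have "x i \<in> borel_measurable ?N" if i: "i \<in> I" for i
    proof -
      have "(\<lambda>\<omega>. x i \<omega> $ l) \<in> borel_measurable ?N" for l
      proof (rule measurableI)
        fix C :: "real set" assume C: "C \<in> sets borel"
        have "(\<lambda>\<omega>. x i \<omega> $ l) -` C \<inter> space ?N = box (\<lambda>k. if k = (i, l) then C else UNIV)"
          using i Pow by (auto simp: box_def Z_def K_def)
        then show "(\<lambda>\<omega>. x i \<omega> $ l) -` C \<inter> space ?N \<in> sets ?N"
          using C Pow by (auto simp: G_def)
      qed auto
      then show ?thesis
        by (subst borel_measurable_euclidean_space) (auto simp: Basis_vec_def inner_axis)
    qed
    then have "sets (generated_by M I x) \<subseteq> sets ?N"
      by (intro sets_generated_by_subset) (simp_all add: Pow)
    with A Pow show ?thesis by auto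
  qed
  with stable G_sets f f0 G0 show ?thesis by (rule integral_indicator_sigma_sets_eq_0)
qed

text \<open>The single vector \<open>y\<close> is treated as a family indexed by the unit
  type.\<close>

lemma integral_indicator_vimage_eq_0:
  fixes f :: "'a \<Rightarrow> real" and y :: "'a \<Rightarrow> real ^ 'd"
  assumes f: "integrable M f" and y: "y \<in> borel_measurable M"
    and trig: "\<And>a \<theta>. (\<integral>\<omega>. f \<omega> * cos (a \<bullet> y \<omega> + \<theta>) \<partial>M) = 0"
    and D: "D \<in> sets (vimage_algebra (space M) y borel)"
  shows "(\<integral>\<omega>. f \<omega> * indicator D \<omega> \<partial>M) = 0"
proof (rule integral_indicator_generated_by_eq_0[of "{()}" M f "\<lambda>_. y"])
  have "sets (vimage_algebra (space M) y borel) \<subseteq> sets (generated_by M {()} (\<lambda>_. y))"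
    by (rule sets_image_in_sets) (simp, rule measurable_generated_by[where x = "\<lambda>_. y"], simp)
  with D show "D \<in> sets (generated_by M {()} (\<lambda>_. y))" by blast
qed (use f y trig in auto)

text \<open>Orthants are closed under intersection, since componentwise infima exist, and they
  generate the Borel sets. This is the passage from a distribution function to all events of
  \<open>y\<close>.\<close>

lemma integral_indicator_vimage_eq_0_if_atMost:
  fixes f :: "'a \<Rightarrow> real" and y :: "'a \<Rightarrow> 'b :: ordered_euclidean_space"
  assumes f: "integrable M f" "(\<integral>\<omega>. f \<omega> \<partial>M) = 0" and y [measurable]: "y \<in> borel_measurable M"
    and le: "\<And>c. (\<integral>\<omega>. f \<omega> * indicator {\<omega> \<in> space M. y \<omega> \<le> c} \<omega> \<partial>M) = 0"
    and D: "D \<in> sets (vimage_algebra (space M) y borel)"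
  shows "(\<integral>\<omega>. f \<omega> * indicator D \<omega> \<partial>M) = 0"
proof (rule integral_indicator_sigma_sets_eq_0)
  let ?G = "range (\<lambda>c. {\<omega> \<in> space M. y \<omega> \<le> c})"
  show "Int_stable ?G"
  proof (rule Int_stableI_image)
    fix c d :: 'b
    show "\<exists>e\<in>UNIV. {\<omega> \<in> space M. y \<omega> \<le> c} \<inter> {\<omega> \<in> space M. y \<omega> \<le> d} = {\<omega> \<in> space M. y \<omega> \<le> e}"
      by (intro bexI[of _ "inf c d"]) auto
  qed
  show "?G \<subseteq> sets M"
  proof safe
    fix c
    have "y -` {..c} \<inter> space M \<in> sets M"
      by (rule measurable_sets[OF y]) (simp add: borel_closed)
    also have "y -` {..c} \<inter> space M = {\<omega> \<in> space M. y \<omega> \<le> c}" by auto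
    finally show "{\<omega> \<in> space M. y \<omega> \<le> c} \<in> sets M" .
  qed
  let ?N = "sigma (space M) ?G"
  have Pow: "?G \<subseteq> Pow (space M)" by auto
  have "y \<in> ?N \<rightarrow>\<^sub>M borel"
    unfolding borel_eq_atMost
  proof (rule measurable_measure_of)
    fix S :: "'b set" assume "S \<in> range (\<lambda>a. {..a})"
    then obtain c where "S = {..c}" by auto
    then have "y -` S \<inter> space ?N = {\<omega> \<in> space M. y \<omega> \<le> c}" using Pow by auto
    then show "y -` S \<inter> space ?N \<in> sets ?N" using Pow by auto
  qed auto
  then have "sets (vimage_algebra (space M) y borel) \<subseteq> sets ?N"
    by (intro sets_image_in_sets) (auto simp: Pow)
  with D Pow show "D \<in> sigma_sets (space M) ?G" by auto
  show "(\<integral>\<omega>. f \<omega> * indicator A \<omega> \<partial>M) = 0" if "A \<in> ?G" for A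
    using that le by auto
qed (rule f)+

section \<open>Linear functionals of a Gaussian family\<close>

text \<open>Equality is almost sure because the model equations are. Measurability is a separate
  requirement, since agreeing almost surely with a measurable function does not imply it when
  \<open>M\<close> is not complete.\<close>

definition lin_functionals ::
    "'a measure \<Rightarrow> 'i set \<Rightarrow> ('i \<Rightarrow> 'a \<Rightarrow> real ^ 'd) \<Rightarrow> ('a \<Rightarrow> real) set" where
  "lin_functionals M I X =
     {f \<in> borel_measurable M. \<exists>a. AE \<omega> in M. f \<omega> = (\<Sum>i\<in>I. a i \<bullet> X i \<omega>)}"

lemma lin_functionalsI:
  assumes "f \<in> borel_measurable M" "AE \<omega> in M. f \<omega> = (\<Sum>i\<in>I. a i \<bullet> X i \<omega>)"
  shows "f \<in> lin_functionals M I X"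
  using assms by (auto simp: lin_functionals_def)

lemma lin_functionals_measurable:
  "f \<in> lin_functionals M I X \<Longrightarrow> f \<in> borel_measurable M"
  by (simp add: lin_functionals_def)

lemma lin_functionals_AE_cong:
  assumes "f \<in> lin_functionals M I X" "g \<in> borel_measurable M" "AE \<omega> in M. g \<omega> = f \<omega>"
  shows "g \<in> lin_functionals M I X"
proof -
  from assms obtain a where "AE \<omega> in M. f \<omega> = (\<Sum>i\<in>I. a i \<bullet> X i \<omega>)"
    by (auto simp: lin_functionals_def)
  with assms(3) have "AE \<omega> in M. g \<omega> = (\<Sum>i\<in>I. a i \<bullet> X i \<omega>)" by eventually_elim simp
  with assms(2) show ?thesis by (rule lin_functionalsI)
qed

lemma lin_functionals_0: "(\<lambda>_. 0) \<in> lin_functionals M I X"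
  by (rule lin_functionalsI[where a = "\<lambda>_. 0"]) auto

lemma lin_functionals_add:
  assumes "f \<in> lin_functionals M I X" "g \<in> lin_functionals M I X"
  shows "(\<lambda>\<omega>. f \<omega> + g \<omega>) \<in> lin_functionals M I X"
proof -
  from assms obtain a b where ab: "AE \<omega> in M. f \<omega> = (\<Sum>i\<in>I. a i \<bullet> X i \<omega>)"
    "AE \<omega> in M. g \<omega> = (\<Sum>i\<in>I. b i \<bullet> X i \<omega>)"
    by (auto simp: lin_functionals_def)
  then have "AE \<omega> in M. f \<omega> + g \<omega> = (\<Sum>i\<in>I. (a i + b i) \<bullet> X i \<omega>)"
    by eventually_elim (simp add: inner_add_left sum.distrib)
  moreover have "(\<lambda>\<omega>. f \<omega> + g \<omega>) \<in> borel_measurable M"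
    using assms by (intro borel_measurable_add lin_functionals_measurable)
  ultimately show ?thesis by (intro lin_functionalsI)
qed

lemma lin_functionals_cmult:
  assumes "f \<in> lin_functionals M I X"
  shows "(\<lambda>\<omega>. c * f \<omega>) \<in> lin_functionals M I X"
proof -
  from assms obtain a where "AE \<omega> in M. f \<omega> = (\<Sum>i\<in>I. a i \<bullet> X i \<omega>)"
    by (auto simp: lin_functionals_def)
  then have "AE \<omega> in M. c * f \<omega> = (\<Sum>i\<in>I. (c *\<^sub>R a i) \<bullet> X i \<omega>)"
    by eventually_elim (simp add: sum_distrib_left)
  moreover have "(\<lambda>\<omega>. c * f \<omega>) \<in> borel_measurable M"
    using lin_functionals_measurable[OF assms] by simp
  ultimately show ?thesis by (intro lin_functionalsI)
qed

lemma lin_functionals_diff: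
  assumes "f \<in> lin_functionals M I X" "g \<in> lin_functionals M I X"
  shows "(\<lambda>\<omega>. f \<omega> - g \<omega>) \<in> lin_functionals M I X"
  using lin_functionals_add[OF assms(1) lin_functionals_cmult[OF assms(2), of "-1"]] by simp

lemma lin_functionals_sum:
  assumes "\<And>k. k \<in> K \<Longrightarrow> f k \<in> lin_functionals M I X"
  shows "(\<lambda>\<omega>. \<Sum>k\<in>K. f k \<omega>) \<in> lin_functionals M I X"
  using assms
  by (induction K rule: infinite_finite_induct) (auto intro: lin_functionals_0 lin_functionals_add)

lemma lin_functionals_base:
  assumes "finite I" "i \<in> I" "X i \<in> borel_measurable M"
  shows "(\<lambda>\<omega>. v \<bullet> X i \<omega>) \<in> lin_functionals M I X"
proof (rule lin_functionalsI[where a = "\<lambda>j. if j = i then v else 0"])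
  have "(\<Sum>j\<in>I. (if j = i then v else 0) \<bullet> X j \<omega>) = (\<Sum>j\<in>I. if j = i then v \<bullet> X j \<omega> else 0)" for \<omega>
    by (intro sum.cong) auto
  with assms show "AE \<omega> in M. v \<bullet> X i \<omega> = (\<Sum>j\<in>I. (if j = i then v else 0) \<bullet> X j \<omega>)" by simp
qed (use assms in auto)

lemma lin_functionals_trans:
  assumes "f \<in> lin_functionals M I X"
    and "\<And>i v. i \<in> I \<Longrightarrow> (\<lambda>\<omega>. v \<bullet> X i \<omega>) \<in> lin_functionals M J Z"
  shows "f \<in> lin_functionals M J Z"
proof -
  from assms(1) obtain a where a: "AE \<omega> in M. f \<omega> = (\<Sum>i\<in>I. a i \<bullet> X i \<omega>)"
    by (auto simp: lin_functionals_def)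
  have "(\<lambda>\<omega>. \<Sum>i\<in>I. a i \<bullet> X i \<omega>) \<in> lin_functionals M J Z"
    using assms(2) by (rule lin_functionals_sum)
  from this lin_functionals_measurable[OF assms(1)] a show ?thesis
    by (rule lin_functionals_AE_cong)
qed

lemma lin_functionals_mono:
  assumes "f \<in> lin_functionals M I X" "I \<subseteq> J" "finite J"
    and "\<And>i. i \<in> I \<Longrightarrow> X i \<in> borel_measurable M"
  shows "f \<in> lin_functionals M J X"
proof (rule lin_functionals_trans[OF assms(1)])
  fix i v assume "i \<in> I"
  with assms(2-4) show "(\<lambda>\<omega>. v \<bullet> X i \<omega>) \<in> lin_functionals M J X"
    by (intro lin_functionals_base) auto
qed

text \<open>The phase \<open>\<theta>\<close> packs the real and imaginary parts of the
  characteristic function at 1 into one formula. Writing the variance as a second moment keeps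
  \<open>\<sigma>\<close> out of it, so that the point mass and the density case share one
  statement.\<close>

lemma (in prob_space) normal_law_expectation:
  assumes X [measurable]: "X \<in> borel_measurable M"
    and law: "distr M borel X = normal_law \<mu> \<sigma>" and \<sigma>: "0 \<le> \<sigma>"
  shows "integrable M X" "integrable M (\<lambda>\<omega>. (X \<omega>)\<^sup>2)" "expectation X = \<mu>"
    and "\<mu> = 0 \<Longrightarrow> expectation (\<lambda>\<omega>. cos (X \<omega> + \<theta>)) = exp (- expectation (\<lambda>\<omega>. (X \<omega>)\<^sup>2) / 2) * cos \<theta>"
proof -
  have "integrable M X \<and> integrable M (\<lambda>\<omega>. (X \<omega>)\<^sup>2) \<and> expectation X = \<mu> \<and>
    (\<mu> = 0 \<longrightarrow> expectation (\<lambda>\<omega>. cos (X \<omega> + \<theta>)) = exp (- expectation (\<lambda>\<omega>. (X \<omega>)\<^sup>2) / 2) * cos \<theta>)"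
  proof (cases "\<sigma> = 0")
    case True
    have "AE x in distr M borel X. x = \<mu>"
      unfolding law normal_law_def using True by (simp add: AE_return)
    then have AE: "AE \<omega> in M. X \<omega> = \<mu>" by (subst (asm) AE_distr_iff) auto
    have "AE \<omega> in M. (X \<omega>)\<^sup>2 = \<mu>\<^sup>2" "AE \<omega> in M. cos (X \<omega> + \<theta>) = cos (\<mu> + \<theta>)"
      using AE by (eventually_elim, simp)+
    with AE have "expectation X = expectation (\<lambda>_. \<mu>)" "integrable M X \<longleftrightarrow> integrable M (\<lambda>_. \<mu>)"
      "expectation (\<lambda>\<omega>. (X \<omega>)\<^sup>2) = expectation (\<lambda>_. \<mu>\<^sup>2)"
      "integrable M (\<lambda>\<omega>. (X \<omega>)\<^sup>2) \<longleftrightarrow> integrable M (\<lambda>_. \<mu>\<^sup>2)"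
      "expectation (\<lambda>\<omega>. cos (X \<omega> + \<theta>)) = expectation (\<lambda>_. cos (\<mu> + \<theta>))"
      by (intro integral_cong_AE integrable_cong_AE; simp)+
    then show ?thesis by (simp add: prob_space)
  next
    case False
    with \<sigma> have \<sigma>: "\<sigma> > 0" by simp
    have D: "distributed M lborel X (normal_density \<mu> \<sigma>)"
      using law False unfolding distributed_def normal_law_def
      by (auto simp: distr_cong[of M M lborel borel X X])
    have EX: "expectation X = \<mu>" using normal_distributed_expectation[OF \<sigma> D] .
    have "integrable lborel (\<lambda>x. normal_density \<mu> \<sigma> x * (x - \<mu>) ^ k)" for k
      using integrable_normal_moment[OF \<sigma>] .
    then have int: "integrable M (\<lambda>\<omega>. (X \<omega> - \<mu>) ^ k)" for k
      by (subst (asm) distributed_integrable[OF D]) auto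
    have iX: "integrable M X" using Bochner_Integration.integrable_add[OF int[of 1] integrable_const[of \<mu>]] by simp
    have "integrable M (\<lambda>\<omega>. (X \<omega> - \<mu>) ^ 2 + 2 * \<mu> * X \<omega> - \<mu>\<^sup>2)"
      using int[of 2] iX by (intro Bochner_Integration.integrable_diff Bochner_Integration.integrable_add) auto
    also have "(\<lambda>\<omega>. (X \<omega> - \<mu>) ^ 2 + 2 * \<mu> * X \<omega> - \<mu>\<^sup>2) = (\<lambda>\<omega>. (X \<omega>)\<^sup>2)"
      by (auto simp: power2_eq_square algebra_simps)
    finally have iX2: "integrable M (\<lambda>\<omega>. (X \<omega>)\<^sup>2)" .
    have "expectation (\<lambda>\<omega>. cos (X \<omega> + \<theta>)) = exp (- expectation (\<lambda>\<omega>. (X \<omega>)\<^sup>2) / 2) * cos \<theta>" if "\<mu> = 0"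
    proof -
      have var: "expectation (\<lambda>\<omega>. (X \<omega>)\<^sup>2) = \<sigma>\<^sup>2"
        using normal_distributed_variance[OF \<sigma> D] EX that by simp
      have "distributed M lborel (\<lambda>\<omega>. X \<omega> / \<sigma>) std_normal_density"
        using D normal_standard_normal_convert[OF \<sigma>, of X \<mu>] that by simp
      then have std: "distr M borel (\<lambda>\<omega>. X \<omega> / \<sigma>) = std_normal_distribution"
        unfolding distributed_def by (auto simp: distr_cong[of M M lborel borel "\<lambda>\<omega>. X \<omega> / \<sigma>"])
      \<comment> \<open>Evaluating the standard normal characteristic function at
        \<open>\<sigma>\<close> undoes the scaling by \<open>1 / \<sigma>\<close>.\<close>
      have "char std_normal_distribution \<sigma> = (CLINT \<omega>|M. iexp (X \<omega>))"
        unfolding std[symmetric] char_def using \<sigma> by (subst integral_distr) auto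
      then have c: "(CLINT \<omega>|M. iexp (X \<omega>)) = complex_of_real (exp (- \<sigma>\<^sup>2 / 2))"
        by (simp add: char_std_normal_distribution)
      have int: "complex_integrable M (\<lambda>\<omega>. iexp (X \<omega>))"
        by (intro integrable_const_bound[where B = 1]) auto
      have "expectation (\<lambda>\<omega>. cos (X \<omega>)) = exp (- \<sigma>\<^sup>2 / 2)"
        using integral_Re[OF int] by (simp add: c Re_exp)
      moreover have "expectation (\<lambda>\<omega>. sin (X \<omega>)) = 0"
        using integral_Im[OF int] by (simp add: c Im_exp)
      moreover have "integrable M (\<lambda>\<omega>. cos (X \<omega>))" "integrable M (\<lambda>\<omega>. sin (X \<omega>))"
        by (intro integrable_const_bound[where B = 1]; simp)+
      ultimately show ?thesis by (simp add: cos_add var)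
    qed
    with iX iX2 EX show ?thesis by simp
  qed
  then show "integrable M X" "integrable M (\<lambda>\<omega>. (X \<omega>)\<^sup>2)" "expectation X = \<mu>"
    "\<mu> = 0 \<Longrightarrow> expectation (\<lambda>\<omega>. cos (X \<omega> + \<theta>)) = exp (- expectation (\<lambda>\<omega>. (X \<omega>)\<^sup>2) / 2) * cos \<theta>"
    by auto
qed

section \<open>Moments and regression of linear functionals of a centred Gaussian family\<close>

locale gaussian_family = prob_space M for M :: "'a measure" +
  fixes L :: "'i set" and z :: "'i \<Rightarrow> 'a \<Rightarrow> real ^ 'd"
  assumes gauss: "jointly_gaussian M L z" and centred: "zero_mean M L z"
begin

abbreviation "H \<equiv> lin_functionals M L z"

lemma z_measurable: "i \<in> L \<Longrightarrow> z i \<in> borel_measurable M"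
  using gauss by (simp add: jointly_gaussian_def)

lemma finite_L: "finite L"
  using gauss by (simp add: jointly_gaussian_def)

lemma functional_law:
  assumes "f \<in> H"
  shows "\<exists>\<mu> \<sigma>. 0 \<le> \<sigma> \<and> distr M borel f = normal_law \<mu> \<sigma>"
proof -
  from assms obtain a where a: "AE \<omega> in M. f \<omega> = (\<Sum>i\<in>L. a i \<bullet> z i \<omega>)"
    by (auto simp: lin_functionals_def)
  have "distr M borel f = distr M borel (\<lambda>\<omega>. \<Sum>i\<in>L. a i \<bullet> z i \<omega>)"
    using assms z_measurable
    by (intro distr_cong_AE a) (auto dest: lin_functionals_measurable)
  with gauss show ?thesis by (simp add: jointly_gaussian_def)
qed

lemma functional_integrable: "f \<in> H \<Longrightarrow> integrable M f"
    and functional_integrable_square: "f \<in> H \<Longrightarrow> integrable M (\<lambda>\<omega>. (f \<omega>)\<^sup>2)"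
proof -
  assume f: "f \<in> H"
  from functional_law[OF f] obtain \<mu> \<sigma> where "0 \<le> \<sigma>" "distr M borel f = normal_law \<mu> \<sigma>"
    by blast
  note normal_law_expectation(1,2)[OF lin_functionals_measurable[OF f] this(2,1)]
  then show "integrable M f" "integrable M (\<lambda>\<omega>. (f \<omega>)\<^sup>2)" by auto
qed

lemma functional_integrable_mult:
  assumes "f \<in> H" "g \<in> H"
  shows "integrable M (\<lambda>\<omega>. f \<omega> * g \<omega>)"
proof (rule Bochner_Integration.integrable_bound)
  show "integrable M (\<lambda>\<omega>. (f \<omega>)\<^sup>2 + (g \<omega>)\<^sup>2)"
    using assms by (intro Bochner_Integration.integrable_add functional_integrable_square)
  have "\<bar>a * b\<bar> \<le> a\<^sup>2 + b\<^sup>2" for a b :: real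
    using sum_squares_bound[of "\<bar>a\<bar>" "\<bar>b\<bar>"] abs_ge_zero[of "a * b"] unfolding abs_mult power2_abs by linarith
  then show "AE \<omega> in M. norm (f \<omega> * g \<omega>) \<le> norm ((f \<omega>)\<^sup>2 + (g \<omega>)\<^sup>2)" by simp
  show "(\<lambda>\<omega>. f \<omega> * g \<omega>) \<in> borel_measurable M"
    using assms by (intro borel_measurable_times lin_functionals_measurable)
qed

lemma base_functional: "i \<in> L \<Longrightarrow> (\<lambda>\<omega>. v \<bullet> z i \<omega>) \<in> H"
  by (intro lin_functionals_base finite_L z_measurable)

lemma base_integrable:
  assumes "i \<in> L" shows "integrable M (z i)"
proof -
  have "integrable M (\<lambda>\<omega>. \<Sum>b\<in>Basis. (b \<bullet> z i \<omega>) *\<^sub>R b)"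
    using base_functional[OF assms] functional_integrable by auto
  then show ?thesis by (simp add: inner_commute[of _ "z i _"] euclidean_representation)
qed

lemma functional_expectation:
  assumes "f \<in> H" shows "expectation f = 0"
proof -
  from assms obtain a where a: "AE \<omega> in M. f \<omega> = (\<Sum>i\<in>L. a i \<bullet> z i \<omega>)"
    by (auto simp: lin_functionals_def)
  have "expectation f = expectation (\<lambda>\<omega>. \<Sum>i\<in>L. a i \<bullet> z i \<omega>)"
    using assms z_measurable by (intro integral_cong_AE a) (auto dest: lin_functionals_measurable)
  also have "\<dots> = (\<Sum>i\<in>L. a i \<bullet> (\<integral>\<omega>. z i \<omega> \<partial>M))"
    using base_integrable by (subst Bochner_Integration.integral_sum) (auto simp: integral_inner_right)
  also have "\<dots> = 0" using centred by (simp add: zero_mean_def)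
  finally show ?thesis .
qed

lemma functional_cos:
  assumes "f \<in> H"
  shows "expectation (\<lambda>\<omega>. cos (f \<omega> + \<theta>)) = exp (- expectation (\<lambda>\<omega>. (f \<omega>)\<^sup>2) / 2) * cos \<theta>"
proof -
  from functional_law[OF assms] obtain \<mu> \<sigma> where "0 \<le> \<sigma>" "distr M borel f = normal_law \<mu> \<sigma>"
    by blast
  note normal_law_expectation(3,4)[OF lin_functionals_measurable[OF assms] this(2,1)]
  with functional_expectation[OF assms] show ?thesis by simp
qed

text \<open>Gram-Schmidt, one regressor at a time: \<open>R\<close> and \<open>W\<close> are the
  residuals of \<open>f\<close> and of the new regressor \<open>Z l\<close> on the old ones, and the
  component of \<open>R\<close> along \<open>W\<close> is subtracted. The regressors may be linearly
  dependent.\<close>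

lemma functional_regression:
  assumes "finite K" "\<And>k. k \<in> K \<Longrightarrow> Z k \<in> H" "f \<in> H"
  shows "\<exists>b. \<forall>k\<in>K. expectation (\<lambda>\<omega>. (f \<omega> - (\<Sum>k\<in>K. b k * Z k \<omega>)) * Z k \<omega>) = 0"
  using assms
proof (induction K arbitrary: f rule: finite_induct)
  case empty
  then show ?case by simp
next
  case (insert l K)
  obtain b where b: "\<And>k. k \<in> K \<Longrightarrow> expectation (\<lambda>\<omega>. (f \<omega> - (\<Sum>k\<in>K. b k * Z k \<omega>)) * Z k \<omega>) = 0"
    using insert.IH[of f] insert.prems by auto
  obtain c where c: "\<And>k. k \<in> K \<Longrightarrow> expectation (\<lambda>\<omega>. (Z l \<omega> - (\<Sum>k\<in>K. c k * Z k \<omega>)) * Z k \<omega>) = 0"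
    using insert.IH[of "Z l"] insert.prems by auto
  define R W where "R = (\<lambda>\<omega>. f \<omega> - (\<Sum>k\<in>K. b k * Z k \<omega>))"
    and "W = (\<lambda>\<omega>. Z l \<omega> - (\<Sum>k\<in>K. c k * Z k \<omega>))"
  have RH: "R \<in> H" and WH: "W \<in> H"
    unfolding R_def W_def using insert.prems
    by (auto intro!: lin_functionals_diff lin_functionals_sum lin_functionals_cmult)
  \<comment> \<open>If \<open>W\<close> has second moment 0, division by 0 makes \<open>t\<close>
    equal to 0; then \<open>W\<close> vanishes almost surely, so orthogonality to \<open>W\<close>
    still holds.\<close>
  define t where "t = expectation (\<lambda>\<omega>. R \<omega> * W \<omega>) / expectation (\<lambda>\<omega>. W \<omega> * W \<omega>)"
  define Q where "Q = (\<lambda>\<omega>. R \<omega> - t * W \<omega>)"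
  have QH: "Q \<in> H" unfolding Q_def by (intro lin_functionals_diff lin_functionals_cmult RH WH)
  have Q_eq: "expectation (\<lambda>\<omega>. Q \<omega> * g \<omega>)
      = expectation (\<lambda>\<omega>. R \<omega> * g \<omega>) - t * expectation (\<lambda>\<omega>. W \<omega> * g \<omega>)" if "g \<in> H" for g
    unfolding Q_def using functional_integrable_mult[OF RH that] functional_integrable_mult[OF WH that]
    by (simp add: left_diff_distrib mult.assoc)
  have QK: "expectation (\<lambda>\<omega>. Q \<omega> * Z k \<omega>) = 0" if "k \<in> K" for k
    using Q_eq[of "Z k"] b[OF that] c[OF that] insert.prems that by (simp add: R_def W_def)
  have QW: "expectation (\<lambda>\<omega>. Q \<omega> * W \<omega>) = 0"
  proof (cases "expectation (\<lambda>\<omega>. W \<omega> * W \<omega>) = 0")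
    case True
    then have "AE \<omega> in M. W \<omega> * W \<omega> = 0"
      using integral_nonneg_eq_0_iff_AE[OF functional_integrable_mult[OF WH WH]] by auto
    then have "AE \<omega> in M. Q \<omega> * W \<omega> = 0" by eventually_elim simp
    then show ?thesis by (rule integral_eq_zero_AE)
  next
    case False
    then show ?thesis using Q_eq[OF WH] by (simp add: t_def)
  qed
  \<comment> \<open>\<open>Z l\<close> is \<open>W\<close> plus a combination of the old regressors,
    and \<open>Q\<close> is orthogonal to each of these.\<close>
  have Ql: "expectation (\<lambda>\<omega>. Q \<omega> * Z l \<omega>) = 0"
  proof -
    have "expectation (\<lambda>\<omega>. Q \<omega> * Z l \<omega>)
        = expectation (\<lambda>\<omega>. Q \<omega> * W \<omega> + (\<Sum>k\<in>K. c k * (Q \<omega> * Z k \<omega>)))"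
      by (intro Bochner_Integration.integral_cong)
        (auto simp: W_def algebra_simps sum_distrib_left)
    also have "\<dots> = expectation (\<lambda>\<omega>. Q \<omega> * W \<omega>) + (\<Sum>k\<in>K. c k * expectation (\<lambda>\<omega>. Q \<omega> * Z k \<omega>))"
      using functional_integrable_mult[OF QH] WH insert.prems by simp
    also have "\<dots> = 0" using QW QK by simp
    finally show ?thesis .
  qed
  define d where "d = (\<lambda>k. if k = l then t else b k - t * c k)"
  have "Q \<omega> = f \<omega> - (\<Sum>k\<in>insert l K. d k * Z k \<omega>)" for \<omega>
  proof -
    have "(\<Sum>k\<in>K. d k * Z k \<omega>) = (\<Sum>k\<in>K. b k * Z k \<omega>) - t * (\<Sum>k\<in>K. c k * Z k \<omega>)"
      unfolding sum_distrib_left sum_subtractf[symmetric] using insert.hyps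
      by (intro sum.cong) (auto simp: d_def algebra_simps)
    then show ?thesis
      using insert.hyps by (simp add: Q_def R_def W_def d_def algebra_simps)
  qed
  then show ?case using QK Ql by (intro exI[of _ d]) auto
qed

end

section \<open>Conditional expectation of events\<close>

text \<open>The hypothesis on events says that the conditional expectation of \<open>f\<close> given
  \<open>F\<close> is 0; pulling out \<open>h\<close> then only asks that the product be integrable.
  This is how relations known for events reach unbounded linear functionals.\<close>

lemma (in sigma_finite_subalgebra) integral_mult_eq_0:
  fixes f h :: "'a \<Rightarrow> real"
  assumes f: "integrable M f" and indep: "\<And>A. A \<in> sets F \<Longrightarrow> (\<integral>\<omega>. f \<omega> * indicator A \<omega> \<partial>M) = 0"
    and h: "h \<in> borel_measurable F" "integrable M (\<lambda>\<omega>. h \<omega> * f \<omega>)"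
  shows "(\<integral>\<omega>. h \<omega> * f \<omega> \<partial>M) = 0"
proof -
  have "AE \<omega> in M. real_cond_exp M F f \<omega> = 0"
    using f indep by (intro real_cond_exp_charact) (auto simp: set_lebesgue_integral_def mult.commute)
  then have "AE \<omega> in M. h \<omega> * real_cond_exp M F f \<omega> = 0" by eventually_elim simp
  then have "(\<integral>\<omega>. h \<omega> * real_cond_exp M F f \<omega> \<partial>M) = 0" by (rule integral_eq_zero_AE)
  then show ?thesis using real_cond_exp_intg(2)[OF h(2,1)] f by simp
qed

lemma subalgebra_vimage_algebra:
  assumes "y \<in> M \<rightarrow>\<^sub>M N"
  shows "subalgebra M (vimage_algebra (space M) y N)"
  unfolding subalgebra_def using sets_image_in_sets[OF refl assms] by simp

lemma (in prob_space) sigma_finite_subalgebraI: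
  assumes "subalgebra M F" shows "sigma_finite_subalgebra M F"
  using assms finite_measure_axioms
  by (intro finite_measure_subalgebra_is_sigma_finite)
    (simp add: finite_measure_subalgebra_def finite_measure_subalgebra_axioms_def)

lemma (in prob_space) integrable_indicator_event:
  "A \<in> events \<Longrightarrow> integrable M (indicator A :: 'a \<Rightarrow> real)"
  by (intro integrable_real_indicator) (auto simp: emeasure_eq_measure)

text \<open>The component of the indicator of \<open>A\<close> orthogonal to the variables
  measurable for \<open>F\<close>. It has mean 0 and is almost surely bounded by 1, so it can serve
  as a weight in the uniqueness results.\<close>

definition cond_residual :: "'a measure \<Rightarrow> 'a measure \<Rightarrow> 'a set \<Rightarrow> 'a \<Rightarrow> real" where
  "cond_residual M F A \<omega> = indicator A \<omega> - real_cond_exp M F (indicator A) \<omega>"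

context prob_space
begin

lemma cond_residual:
  assumes F: "subalgebra M F" and A: "A \<in> sets M"
  shows "integrable M (cond_residual M F A)"
    and "AE \<omega> in M. \<bar>cond_residual M F A \<omega>\<bar> \<le> 1"
    and "\<lbrakk>c \<in> borel_measurable F; integrable M c\<rbrakk> \<Longrightarrow> expectation (\<lambda>\<omega>. c \<omega> * cond_residual M F A \<omega>) = 0"
    and "expectation (cond_residual M F A) = 0"
proof -
  interpret F: sigma_finite_subalgebra M F using F by (rule sigma_finite_subalgebraI)
  have iA: "integrable M (indicator A :: 'a \<Rightarrow> real)" using A by (rule integrable_indicator_event)
  show int: "integrable M (cond_residual M F A)"
    unfolding cond_residual_def using iA by auto
  have "AE \<omega> in M. real_cond_exp M F (indicator A) \<omega> \<ge> 0"
    by (rule F.real_cond_exp_ge_c) (use iA in auto)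
  moreover have "AE \<omega> in M. real_cond_exp M F (indicator A) \<omega> \<le> 1"
    by (rule F.real_cond_exp_le_c) (use iA in \<open>auto simp: indicator_def\<close>)
  ultimately show "AE \<omega> in M. \<bar>cond_residual M F A \<omega>\<bar> \<le> 1"
    by eventually_elim (auto simp: cond_residual_def indicator_def)
  have orth: "expectation (\<lambda>\<omega>. c \<omega> * cond_residual M F A \<omega>) = 0"
    if c: "c \<in> borel_measurable F" "integrable M c" for c
  proof -
    have cA: "integrable M (\<lambda>\<omega>. c \<omega> * indicator A \<omega>)"
      using A by (intro integrable_mult_bounded c) (auto simp: indicator_def)
    note intg = F.real_cond_exp_intg[OF cA c(1)]
    show ?thesis unfolding cond_residual_def right_diff_distrib
      using intg cA A by simp
  qed
  then show "\<lbrakk>c \<in> borel_measurable F; integrable M c\<rbrakk> \<Longrightarrow> expectation (\<lambda>\<omega>. c \<omega> * cond_residual M F A \<omega>) = 0" .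
  show "expectation (cond_residual M F A) = 0"
    using orth[OF borel_measurable_const integrable_const, of 1] unfolding mult_1 .
qed

text \<open>Conditional expectation is self-adjoint.\<close>

lemma cond_residual_indicator:
  assumes F: "subalgebra M F" and A: "A \<in> sets M" and D: "D \<in> sets M"
  shows "expectation (\<lambda>\<omega>. cond_residual M F A \<omega> * indicator D \<omega>)
    = expectation (\<lambda>\<omega>. indicator A \<omega> * cond_residual M F D \<omega>)"
proof -
  interpret F: sigma_finite_subalgebra M F using F by (rule sigma_finite_subalgebraI)
  let ?E = "\<lambda>A. real_cond_exp M F (indicator A)"
  have iD: "integrable M (indicator D :: 'a \<Rightarrow> real)" using D by (rule integrable_indicator_event)
  have r: "integrable M (\<lambda>\<omega>. cond_residual M F A \<omega> * g \<omega>)"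
      "integrable M (\<lambda>\<omega>. g \<omega> * cond_residual M F D \<omega>)" if "integrable M g" for g
    using integrable_mult_bounded[OF that _ cond_residual(2)[OF F A]]
      integrable_mult_bounded[OF that _ cond_residual(2)[OF F D]]
      cond_residual(1)[OF F A] cond_residual(1)[OF F D] by auto
  \<comment> \<open>Both sides equal the expectation of the product of the two residuals: an
    indicator is its residual plus its conditional probability, and the latter is orthogonal to the
    other residual.\<close>
  have "expectation (\<lambda>\<omega>. cond_residual M F A \<omega> * indicator D \<omega>)
    = expectation (\<lambda>\<omega>. cond_residual M F A \<omega> * cond_residual M F D \<omega>) + expectation (\<lambda>\<omega>. ?E D \<omega> * cond_residual M F A \<omega>)"
    using r(1)[OF cond_residual(1)[OF F D]] r(1)[OF F.real_cond_exp_int(1)[OF iD]]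
    by (subst Bochner_Integration.integral_add[symmetric])
      (auto simp: mult.commute cond_residual_def[of M F D] algebra_simps)
  moreover have "expectation (\<lambda>\<omega>. indicator A \<omega> * cond_residual M F D \<omega>)
    = expectation (\<lambda>\<omega>. cond_residual M F A \<omega> * cond_residual M F D \<omega>) + expectation (\<lambda>\<omega>. ?E A \<omega> * cond_residual M F D \<omega>)"
    using r(2)[OF cond_residual(1)[OF F A]] r(2)[OF F.real_cond_exp_int(1)[OF integrable_indicator_event[OF A]]]
    by (subst Bochner_Integration.integral_add[symmetric])
      (auto simp: mult.commute cond_residual_def[of M F A] algebra_simps)
  ultimately show ?thesis
    using cond_residual(3)[OF F A, of "?E D"] cond_residual(3)[OF F D, of "?E A"] A D
      F.real_cond_exp_int(1) integrable_indicator_event by simp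
qed

text \<open>The right-hand side is conditional independence of \<open>F\<close> and \<open>y\<close>
  given \<open>G\<close>. Self-adjointness moves the residual from the orthant
  \<open>{y \<le> c}\<close> to the event \<open>A\<close>, leaving a weight that is the same for
  every event of \<open>y\<close>, so orthants can be replaced by arbitrary events of
  \<open>y\<close>.\<close>

lemma real_cond_exp_atMost_eq_iff:
  fixes y :: "'a \<Rightarrow> 'b :: ordered_euclidean_space"
  assumes F: "subalgebra M F" and G: "subalgebra F G" and y: "y \<in> borel_measurable M"
  shows "(\<forall>c. AE \<omega> in M. real_cond_exp M F (indicator {\<omega> \<in> space M. y \<omega> \<le> c}) \<omega>
            = real_cond_exp M G (indicator {\<omega> \<in> space M. y \<omega> \<le> c}) \<omega>)
    \<longleftrightarrow> (\<forall>A\<in>sets F. \<forall>D\<in>sets (vimage_algebra (space M) y borel).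
           expectation (\<lambda>\<omega>. cond_residual M G A \<omega> * indicator D \<omega>) = 0)"
    (is "?L \<longleftrightarrow> ?R")
proof -
  let ?D = "\<lambda>c. {\<omega> \<in> space M. y \<omega> \<le> c}"
  have MG: "subalgebra M G" using F G unfolding subalgebra_def by auto
  interpret F: sigma_finite_subalgebra M F using F by (rule sigma_finite_subalgebraI)
  interpret G: sigma_finite_subalgebra M G using MG by (rule sigma_finite_subalgebraI)
  have FM: "A \<in> sets M" if "A \<in> sets F" for A using that F by (auto simp: subalgebra_def)
  have Dy: "?D c \<in> sets (vimage_algebra (space M) y borel)" for c
  proof -
    have "y -` {..c} \<inter> space M \<in> sets (vimage_algebra (space M) y borel)"
      by (rule in_vimage_algebra) (simp add: borel_closed)
    also have "y -` {..c} \<inter> space M = ?D c" by auto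
    finally show ?thesis .
  qed
  then have DM: "?D c \<in> sets M" for c
    using subalgebra_vimage_algebra[OF y] by (auto simp: subalgebra_def)
  have iD: "integrable M (indicator (?D c) :: 'a \<Rightarrow> real)" for c using DM by (rule integrable_indicator_event)
  show ?thesis
  proof
    assume L: ?L
    show ?R
    proof (intro ballI)
      fix A D assume A: "A \<in> sets F" and D: "D \<in> sets (vimage_algebra (space M) y borel)"
      note A' = FM[OF A]
      show "expectation (\<lambda>\<omega>. cond_residual M G A \<omega> * indicator D \<omega>) = 0"
      proof (rule integral_indicator_vimage_eq_0_if_atMost[OF _ _ y _ D])
        fix c
        \<comment> \<open>By hypothesis the residual of the orthant given \<open>G\<close> may be
          replaced by the one given \<open>F\<close>, which is orthogonal to the event
          \<open>A\<close> of \<open>F\<close>.\<close>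
        have "AE \<omega> in M. indicator A \<omega> * cond_residual M G (?D c) \<omega> = indicator A \<omega> * cond_residual M F (?D c) \<omega>"
          using L[rule_format, of c] by eventually_elim (simp add: cond_residual_def)
        then have "expectation (\<lambda>\<omega>. indicator A \<omega> * cond_residual M G (?D c) \<omega>)
            = expectation (\<lambda>\<omega>. indicator A \<omega> * cond_residual M F (?D c) \<omega>)"
          using cond_residual(1)[OF F DM] cond_residual(1)[OF MG DM] A'
          by (intro integral_cong_AE) (auto intro!: borel_measurable_times)
        also have "\<dots> = 0"
          using A A' by (intro cond_residual(3)[OF F DM] integrable_indicator_event) auto
        finally show "expectation (\<lambda>\<omega>. cond_residual M G A \<omega> * indicator (?D c) \<omega>) = 0"
          using cond_residual_indicator[OF MG A' DM] by simp
      qed (use cond_residual[OF MG A'] in auto)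
    qed
  next
    assume R: ?R
    show ?L
    proof
      fix c
      show "AE \<omega> in M. real_cond_exp M F (indicator (?D c)) \<omega> = real_cond_exp M G (indicator (?D c)) \<omega>"
      proof (rule F.real_cond_exp_charact)
        show "integrable M (indicator (?D c) :: 'a \<Rightarrow> real)" by (rule iD)
        show "integrable M (real_cond_exp M G (indicator (?D c)))"
          using iD by (rule G.real_cond_exp_int)
        show "real_cond_exp M G (indicator (?D c)) \<in> borel_measurable F"
          by (rule measurable_from_subalg[OF G]) simp
        fix A assume A: "A \<in> sets F"
        note A' = FM[OF A]
        have "expectation (\<lambda>\<omega>. indicator A \<omega> * cond_residual M G (?D c) \<omega>) = 0"
          using R A Dy cond_residual_indicator[OF MG A' DM] by simp
        then have eq: "expectation (\<lambda>\<omega>. indicator A \<omega> * indicator (?D c) \<omega>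
            - indicator A \<omega> * real_cond_exp M G (indicator (?D c)) \<omega>) = 0"
          by (simp only: cond_residual_def right_diff_distrib)
        have int1: "integrable M (\<lambda>\<omega>. indicator A \<omega> * real_cond_exp M G (indicator (?D c)) \<omega>)"
          using A' by (intro integrable_mult_bounded(2) G.real_cond_exp_int(1) iD) (auto simp: indicator_abs_le_1)
        have int2: "integrable M (\<lambda>\<omega>. indicator A \<omega> * (indicator (?D c) \<omega> :: real))"
          using A' by (intro integrable_mult_bounded(2) iD) (auto simp: indicator_abs_le_1)
        show "(LINT \<omega>:A|M. indicator (?D c) \<omega>) = (LINT \<omega>:A|M. real_cond_exp M G (indicator (?D c)) \<omega>)"
          using eq unfolding Bochner_Integration.integral_diff[OF int2 int1] set_lebesgue_integral_def real_scaleR_def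
          by linarith
      qed
    qed
  qed
qed

end

section \<open>Spans of random vectors and regression\<close>

text \<open>Testing with scalar products avoids carrying coefficient matrices: closure properties
  reduce to those of scalar functionals.\<close>

definition lin_span ::
    "'a measure \<Rightarrow> 'i set \<Rightarrow> ('i \<Rightarrow> 'a \<Rightarrow> real ^ 'd) \<Rightarrow> ('a \<Rightarrow> real ^ 'd) set" where
  "lin_span M I X = {Y. \<forall>v. (\<lambda>\<omega>. v \<bullet> Y \<omega>) \<in> lin_functionals M I X}"

text \<open>A bilinear form of the condition that the covariance matrix is 0. It has no centring,
  since it is applied to vectors of mean 0.\<close>

definition uncorrelated :: "'a measure \<Rightarrow> ('a \<Rightarrow> real ^ 'd) \<Rightarrow> ('a \<Rightarrow> real ^ 'd) \<Rightarrow> bool" where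
  "uncorrelated M Y W \<longleftrightarrow> (\<forall>u v. (\<integral>\<omega>. (u \<bullet> Y \<omega>) * (v \<bullet> W \<omega>) \<partial>M) = 0)"

lemma uncorrelated_sym: "uncorrelated M Y W \<Longrightarrow> uncorrelated M W Y"
  unfolding uncorrelated_def by (subst mult.commute) blast

lemma lin_spanD: "Y \<in> lin_span M I X \<Longrightarrow> (\<lambda>\<omega>. v \<bullet> Y \<omega>) \<in> lin_functionals M I X"
  by (simp add: lin_span_def)

lemma lin_span_component:
  assumes "Y \<in> lin_span M I X" shows "(\<lambda>\<omega>. Y \<omega> $ l) \<in> lin_functionals M I X"
  using lin_spanD[OF assms, of "axis l 1"] by (simp add: inner_axis')

lemma lin_span_measurable:
  assumes "Y \<in> lin_span M I X" shows "Y \<in> borel_measurable M"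
proof (subst borel_measurable_euclidean_space, intro ballI)
  fix b
  show "(\<lambda>\<omega>. Y \<omega> \<bullet> b) \<in> borel_measurable M"
    using lin_functionals_measurable[OF lin_spanD[OF assms, of b]] by (simp add: inner_commute)
qed

lemma lin_span_add:
  "Y \<in> lin_span M I X \<Longrightarrow> W \<in> lin_span M I X \<Longrightarrow> (\<lambda>\<omega>. Y \<omega> + W \<omega>) \<in> lin_span M I X"
  by (simp add: lin_span_def inner_add_right lin_functionals_add)

lemma lin_span_diff:
  "Y \<in> lin_span M I X \<Longrightarrow> W \<in> lin_span M I X \<Longrightarrow> (\<lambda>\<omega>. Y \<omega> - W \<omega>) \<in> lin_span M I X"
  by (simp add: lin_span_def inner_diff_right lin_functionals_diff)

lemma lin_span_0: "(\<lambda>_. 0) \<in> lin_span M I X"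
  by (simp add: lin_span_def lin_functionals_0)

lemma lin_span_sum:
  assumes "\<And>k. k \<in> K \<Longrightarrow> Y k \<in> lin_span M I X"
  shows "(\<lambda>\<omega>. \<Sum>k\<in>K. Y k \<omega>) \<in> lin_span M I X"
  using assms by (simp add: lin_span_def inner_sum_right lin_functionals_sum)

lemma lin_span_matrix:
  assumes "Y \<in> lin_span M I X"
  shows "(\<lambda>\<omega>. A *v Y \<omega>) \<in> lin_span M I X"
  using assms by (simp add: lin_span_def flip: dot_lmul_matrix)

lemma lin_span_AE_cong:
  assumes "Y \<in> lin_span M I X" and W: "W \<in> borel_measurable M" and AE: "AE \<omega> in M. W \<omega> = Y \<omega>"
  shows "W \<in> lin_span M I X"
  unfolding lin_span_def
proof safe
  fix v
  have "AE \<omega> in M. v \<bullet> W \<omega> = v \<bullet> Y \<omega>" using AE by eventually_elim simp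
  with lin_spanD[OF assms(1)] _ show "(\<lambda>\<omega>. v \<bullet> W \<omega>) \<in> lin_functionals M I X"
    by (rule lin_functionals_AE_cong) (use W in simp)
qed

lemma lin_span_base:
  assumes "finite I" "i \<in> I" "X i \<in> borel_measurable M"
  shows "X i \<in> lin_span M I X"
  using lin_functionals_base[where X = X, OF assms] by (simp add: lin_span_def)

lemma lin_span_trans:
  assumes "Y \<in> lin_span M I X" "\<And>i. i \<in> I \<Longrightarrow> X i \<in> lin_span M J Z"
  shows "Y \<in> lin_span M J Z"
  unfolding lin_span_def
proof safe
  fix v
  show "(\<lambda>\<omega>. v \<bullet> Y \<omega>) \<in> lin_functionals M J Z"
    using lin_spanD[OF assms(1)] lin_spanD[OF assms(2)] by (rule lin_functionals_trans)
qed

lemma lin_span_mono: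
  assumes "Y \<in> lin_span M I X" "I \<subseteq> J" "finite J" "\<And>i. i \<in> I \<Longrightarrow> X i \<in> borel_measurable M"
  shows "Y \<in> lin_span M J X"
  using assms(1) lin_functionals_mono[OF _ assms(2-4)] by (auto simp: lin_span_def)

section \<open>Covariance and regression for vectors in the span of a Gaussian family\<close>

context gaussian_family
begin

abbreviation "V \<equiv> lin_span M L z"

lemma uncorrelated_functional:
  assumes Y: "Y \<in> V" and X: "\<And>i. i \<in> I \<Longrightarrow> X i \<in> V" and f: "f \<in> lin_functionals M I X"
    and uncorr: "\<And>i. i \<in> I \<Longrightarrow> uncorrelated M Y (X i)"
  shows "expectation (\<lambda>\<omega>. (u \<bullet> Y \<omega>) * f \<omega>) = 0"
proof -
  from f obtain a where a: "AE \<omega> in M. f \<omega> = (\<Sum>i\<in>I. a i \<bullet> X i \<omega>)"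
    by (auto simp: lin_functionals_def)
  have uY: "(\<lambda>\<omega>. u \<bullet> Y \<omega>) \<in> H" using Y by (rule lin_spanD)
  have XH: "(\<lambda>\<omega>. a i \<bullet> X i \<omega>) \<in> H" if "i \<in> I" for i using X[OF that] by (rule lin_spanD)
  have SH: "(\<lambda>\<omega>. \<Sum>i\<in>I. a i \<bullet> X i \<omega>) \<in> H"
    using XH by (rule lin_functionals_sum)
  have "expectation (\<lambda>\<omega>. (u \<bullet> Y \<omega>) * f \<omega>) = expectation (\<lambda>\<omega>. (u \<bullet> Y \<omega>) * (\<Sum>i\<in>I. a i \<bullet> X i \<omega>))"
  proof (rule integral_cong_AE)
    show "AE \<omega> in M. (u \<bullet> Y \<omega>) * f \<omega> = (u \<bullet> Y \<omega>) * (\<Sum>i\<in>I. a i \<bullet> X i \<omega>)"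
      using a by eventually_elim simp
  qed (intro borel_measurable_times lin_functionals_measurable[OF uY]
      lin_functionals_measurable[OF SH] lin_functionals_measurable[OF f])+
  also have "\<dots> = (\<Sum>i\<in>I. expectation (\<lambda>\<omega>. (u \<bullet> Y \<omega>) * (a i \<bullet> X i \<omega>)))"
    unfolding sum_distrib_left using functional_integrable_mult[OF uY XH]
    by (rule Bochner_Integration.integral_sum)
  also have "\<dots> = 0"
    using uncorr by (intro sum.neutral) (simp add: uncorrelated_def)
  finally show ?thesis .
qed

lemma uncorrelated_span:
  assumes "Y \<in> V" "\<And>i. i \<in> I \<Longrightarrow> X i \<in> V" "W \<in> lin_span M I X"
    and "\<And>i. i \<in> I \<Longrightarrow> uncorrelated M Y (X i)"
  shows "uncorrelated M Y W"
  unfolding uncorrelated_def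
  using uncorrelated_functional[OF assms(1,2) lin_spanD[OF assms(3)] assms(4)] by blast

lemma expectation_vector:
  assumes "Y \<in> V" shows "integrable M Y" "expectation Y = 0"
proof -
  have fH: "(\<lambda>\<omega>. b \<bullet> Y \<omega>) \<in> H" for b using assms by (rule lin_spanD)
  have "integrable M (\<lambda>\<omega>. \<Sum>b\<in>Basis. (b \<bullet> Y \<omega>) *\<^sub>R b)"
    using functional_integrable[OF fH] by auto
  then show int: "integrable M Y" by (simp add: inner_commute[of _ "Y _"] euclidean_representation)
  have "b \<bullet> expectation Y = 0" for b
    using functional_expectation[OF fH, of b] int by (subst (asm) integral_inner_right) auto
  from this[of "expectation Y"] show "expectation Y = 0" by simp
qed

lemma Cov_component:
  assumes "Y \<in> V" "W \<in> V"
  shows "Cov M Y W $ k $ l = expectation (\<lambda>\<omega>. Y \<omega> $ k * W \<omega> $ l)"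
  using functional_expectation[OF lin_span_component] assms by (simp add: Cov_def)

lemma Cov_bilinear:
  assumes "Y \<in> V" "W \<in> V"
  shows "u \<bullet> (Cov M Y W *v v) = expectation (\<lambda>\<omega>. (u \<bullet> Y \<omega>) * (v \<bullet> W \<omega>))"
proof -
  have int: "integrable M (\<lambda>\<omega>. Y \<omega> $ k * W \<omega> $ l)" for k l
    using assms by (intro functional_integrable_mult lin_span_component)
  have "u \<bullet> (Cov M Y W *v v)
      = (\<Sum>k\<in>UNIV. \<Sum>l\<in>UNIV. u $ k * v $ l * expectation (\<lambda>\<omega>. Y \<omega> $ k * W \<omega> $ l))"
    by (simp add: inner_vec_def matrix_vector_mult_def Cov_component[OF assms] sum_distrib_left mult_ac)
  also have "\<dots> = (\<Sum>k\<in>UNIV. \<Sum>l\<in>UNIV. expectation (\<lambda>\<omega>. u $ k * v $ l * (Y \<omega> $ k * W \<omega> $ l)))"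
    by simp
  also have "\<dots> = expectation (\<lambda>\<omega>. \<Sum>k\<in>UNIV. \<Sum>l\<in>UNIV. u $ k * v $ l * (Y \<omega> $ k * W \<omega> $ l))"
    using int by (simp add: Bochner_Integration.integral_sum)
  also have "\<dots> = expectation (\<lambda>\<omega>. (u \<bullet> Y \<omega>) * (v \<bullet> W \<omega>))"
    by (intro Bochner_Integration.integral_cong refl)
      (simp add: inner_vec_def sum_product mult_ac)
  finally show ?thesis .
qed

lemma Cov_eq_0_iff:
  assumes "Y \<in> V" "W \<in> V"
  shows "Cov M Y W = 0 \<longleftrightarrow> uncorrelated M Y W"
proof
  assume "Cov M Y W = 0"
  then show "uncorrelated M Y W"
    by (simp add: uncorrelated_def flip: Cov_bilinear[OF assms])
next
  assume "uncorrelated M Y W"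
  then have 0: "u \<bullet> (Cov M Y W *v v) = 0" for u v
    by (simp add: uncorrelated_def Cov_bilinear[OF assms])
  have "Cov M Y W *v v = 0 *v v" for v
    using 0[of "Cov M Y W *v v" v] by simp
  then show "Cov M Y W = 0" unfolding matrix_eq ..
qed

text \<open>A linear combination of span elements is again a linear functional of the base family,
  so joint normality and mean 0 pass to regression residuals.\<close>

lemma jointly_gaussian_span:
  assumes "finite J" "\<And>j. j \<in> J \<Longrightarrow> Y j \<in> V"
  shows "jointly_gaussian M J Y" "zero_mean M J Y"
proof -
  have "\<exists>\<mu> \<sigma>. 0 \<le> \<sigma> \<and> distr M borel (\<lambda>\<omega>. \<Sum>j\<in>J. a j \<bullet> Y j \<omega>) = normal_law \<mu> \<sigma>" for a
    by (intro functional_law lin_functionals_sum lin_spanD assms(2))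
  then show "jointly_gaussian M J Y"
    using assms(1) lin_span_measurable[OF assms(2)] by (simp add: jointly_gaussian_def)
  show "zero_mean M J Y"
    using expectation_vector(2)[OF assms(2)] by (simp add: zero_mean_def)
qed

text \<open>Each coordinate of \<open>y\<close> is regressed on all coordinates of all regressors;
  the coefficients for coordinate \<open>l\<close> form row \<open>l\<close> of the matrices
  \<open>B j\<close>.\<close>

lemma vector_regression:
  assumes J: "finite J" and x: "\<And>j. j \<in> J \<Longrightarrow> x j \<in> V" and y: "y \<in> V"
  shows "\<exists>B. \<forall>j\<in>J. uncorrelated M (\<lambda>\<omega>. y \<omega> - (\<Sum>j\<in>J. B j *v x j \<omega>)) (x j)"
proof -
  define Z where "Z = (\<lambda>k \<omega>. x (fst k) \<omega> $ (snd k :: 'd))"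
  let ?K = "J \<times> (UNIV :: 'd set)"
  have Z: "Z k \<in> H" if "k \<in> ?K" for k
    unfolding Z_def using that by (intro lin_span_component x) auto
  have "\<exists>b. \<forall>k\<in>?K. expectation (\<lambda>\<omega>. (y \<omega> $ l - (\<Sum>k\<in>?K. b k * Z k \<omega>)) * Z k \<omega>) = 0" for l
    using J Z lin_span_component[OF y] by (intro functional_regression) auto
  then have "\<forall>l. \<exists>b. \<forall>k\<in>?K. expectation (\<lambda>\<omega>. (y \<omega> $ l - (\<Sum>k\<in>?K. b k * Z k \<omega>)) * Z k \<omega>) = 0" ..
  from choice[OF this] obtain b where b: "\<And>l k. k \<in> ?K \<Longrightarrow>
      expectation (\<lambda>\<omega>. (y \<omega> $ l - (\<Sum>k\<in>?K. b l k * Z k \<omega>)) * Z k \<omega>) = 0"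
    by blast
  define B :: "_ \<Rightarrow> real ^ 'd ^ 'd" where "B = (\<lambda>j. \<chi> l m. b l (j, m))"
  define e where "e = (\<lambda>\<omega>. y \<omega> - (\<Sum>j\<in>J. B j *v x j \<omega>))"
  have eV: "e \<in> V" unfolding e_def
    by (intro lin_span_diff y lin_span_sum lin_span_matrix x)
  have e: "e \<omega> $ l = y \<omega> $ l - (\<Sum>k\<in>?K. b l k * Z k \<omega>)" for \<omega> l
    by (simp add: e_def B_def Z_def matrix_vector_mult_def sum.cartesian_product case_prod_beta')
  have "Cov M e (x j) = 0" if j: "j \<in> J" for j
    using b[of "(j, _)"] j Cov_component[OF eV x[OF j]]
    unfolding vec_eq_iff zero_index by (simp add: e Z_def)
  then have "\<forall>j\<in>J. uncorrelated M e (x j)"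
    using Cov_eq_0_iff[OF eV x] by blast
  then show ?thesis unfolding e_def by blast
qed

end

section \<open>Conditional distribution functions and regression\<close>

context gaussian_family
begin

lemma sigma_finite_generated_by:
  assumes "\<And>i. i \<in> I \<Longrightarrow> x i \<in> V"
  shows "sigma_finite_subalgebra M (generated_by M I x)"
  using assms by (intro sigma_finite_subalgebraI subalgebra_generated_by lin_span_measurable)

lemma functional_measurable_generated_by:
  assumes "i \<in> I" shows "(\<lambda>\<omega>. v \<bullet> x i \<omega>) \<in> borel_measurable (generated_by M I x)"
  by (intro borel_measurable_inner borel_measurable_const measurable_generated_by assms)

lemma subalgebra_generated_by_mono:
  assumes "J \<subseteq> I" shows "subalgebra (generated_by M I x) (generated_by M J x)"
proof -
  have "sets (generated_by M J x) \<subseteq> sets (generated_by M I x)"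
    using assms by (intro sets_generated_by_subset measurable_generated_by) auto
  then show ?thesis by (simp add: subalgebra_def)
qed

text \<open>Uncorrelated jointly Gaussian variables are independent: the trigonometric moments of the
  pair factorise, and these determine all integrals over the generated \<open>\<sigma>\<close>-algebra.\<close>

lemma expectation_mult_cos_uncorrelated:
  assumes I: "finite I" and x: "\<And>i. i \<in> I \<Longrightarrow> x i \<in> V" and U: "U \<in> H"
    and orth: "\<And>i v. i \<in> I \<Longrightarrow> expectation (\<lambda>\<omega>. U \<omega> * (v \<bullet> x i \<omega>)) = 0"
    and h: "h \<in> borel_measurable (generated_by M I x)" "integrable M h"
  shows "expectation (\<lambda>\<omega>. h \<omega> * cos (U \<omega> + \<phi>)) = expectation h * expectation (\<lambda>\<omega>. cos (U \<omega> + \<phi>))"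
proof -
  interpret F: sigma_finite_subalgebra M "generated_by M I x"
    using x by (rule sigma_finite_generated_by)
  define \<kappa> where "\<kappa> = expectation (\<lambda>\<omega>. cos (U \<omega> + \<phi>))"
  \<comment> \<open>After centring, independence says that this weight integrates to 0 over every
    event generated by the \<open>x i\<close>; the trigonometric criterion tests exactly
    that.\<close>
  define f where "f = (\<lambda>\<omega>. cos (U \<omega> + \<phi>) - \<kappa>)"
  have [measurable]: "U \<in> borel_measurable M" using U by (rule lin_functionals_measurable)
  have int_cos: "integrable M (\<lambda>\<omega>. cos (W \<omega> + \<theta>))" if "W \<in> H" for W \<theta>
    using lin_functionals_measurable[OF that] by (intro integrable_const_bound[where B = 1]) auto
  have f: "integrable M f" unfolding f_def using int_cos[OF U] by simp
  have trig: "expectation (\<lambda>\<omega>. f \<omega> * cos ((\<Sum>i\<in>I. a i \<bullet> x i \<omega>) + \<theta>)) = 0" for a \<theta>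
  proof -
    define S where "S = (\<lambda>\<omega>. \<Sum>i\<in>I. a i \<bullet> x i \<omega>)"
    have xH: "(\<lambda>\<omega>. a i \<bullet> x i \<omega>) \<in> H" if "i \<in> I" for i using x[OF that] by (rule lin_spanD)
    have S: "S \<in> H" unfolding S_def using xH by (rule lin_functionals_sum)
    have add: "(\<lambda>\<omega>. U \<omega> + S \<omega>) \<in> H" using U S by (rule lin_functionals_add)
    have diff: "(\<lambda>\<omega>. U \<omega> - S \<omega>) \<in> H" using U S by (rule lin_functionals_diff)
    have "expectation (\<lambda>\<omega>. U \<omega> * S \<omega>) = (\<Sum>i\<in>I. expectation (\<lambda>\<omega>. U \<omega> * (a i \<bullet> x i \<omega>)))"
      unfolding S_def sum_distrib_left using functional_integrable_mult[OF U xH]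
      by (rule Bochner_Integration.integral_sum)
    also have "\<dots> = 0" using orth by simp
    finally have US: "expectation (\<lambda>\<omega>. U \<omega> * S \<omega>) = 0" .
    note int = functional_integrable_square[OF U] functional_integrable_square[OF S]
      functional_integrable_mult[OF U S]
    define p q where "p = expectation (\<lambda>\<omega>. (U \<omega>)\<^sup>2)" and "q = expectation (\<lambda>\<omega>. (S \<omega>)\<^sup>2)"
    \<comment> \<open>Zero covariance gives \<open>U + S\<close> and \<open>U - S\<close> the same
      variance \<open>p + q\<close>, so both cosine moments carry the same exponential factor, which
      splits into the factors of \<open>U\<close> and \<open>S\<close>.\<close>
    have sq_add: "expectation (\<lambda>\<omega>. (U \<omega> + S \<omega>)\<^sup>2) = p + q"
      using int US by (simp add: power2_sum mult.assoc p_def q_def)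
    have sq_diff: "expectation (\<lambda>\<omega>. (U \<omega> - S \<omega>)\<^sup>2) = p + q"
      using int US by (simp add: power2_diff mult.assoc p_def q_def)
    have "expectation (\<lambda>\<omega>. f \<omega> * cos (S \<omega> + \<theta>))
        = expectation (\<lambda>\<omega>. (cos ((U \<omega> + S \<omega>) + (\<phi> + \<theta>)) + cos ((U \<omega> - S \<omega>) + (\<phi> - \<theta>))) / 2
            - \<kappa> * cos (S \<omega> + \<theta>))"
    proof (intro Bochner_Integration.integral_cong refl)
      fix \<omega>
      have "cos s * cos t = (cos (s + t) + cos (s - t)) / 2" for s t :: real
        by (simp add: cos_add cos_diff)
      from this[of "U \<omega> + \<phi>" "S \<omega> + \<theta>"]
      show "f \<omega> * cos (S \<omega> + \<theta>) = (cos ((U \<omega> + S \<omega>) + (\<phi> + \<theta>)) + cos ((U \<omega> - S \<omega>) + (\<phi> - \<theta>))) / 2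
            - \<kappa> * cos (S \<omega> + \<theta>)"
        by (simp add: f_def left_diff_distrib algebra_simps)
    qed
    also have "\<dots> = (exp (- (p + q) / 2) * cos (\<phi> + \<theta>) + exp (- (p + q) / 2) * cos (\<phi> - \<theta>)) / 2
        - (exp (- p / 2) * cos \<phi>) * (exp (- q / 2) * cos \<theta>)"
      using int_cos[OF add] int_cos[OF diff] int_cos[OF S]
      by (simp add: functional_cos[OF add] functional_cos[OF diff] functional_cos[OF S]
          functional_cos[OF U] sq_add sq_diff \<kappa>_def p_def[symmetric] q_def[symmetric])
    also have "\<dots> = 0"
    proof -
      have "exp (- (p + q) / 2) = exp (- p / 2) * exp (- q / 2)"
        by (simp add: exp_add[symmetric] add_divide_distrib)
      then show ?thesis by (simp add: cos_add cos_diff field_simps)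
    qed
    finally show ?thesis by (simp add: S_def)
  qed
  have f0: "expectation (\<lambda>\<omega>. f \<omega> * indicator A \<omega>) = 0" if "A \<in> sets (generated_by M I x)" for A
    using I f lin_span_measurable[OF x] trig that by (rule integral_indicator_generated_by_eq_0)
  have int1: "integrable M (\<lambda>\<omega>. h \<omega> * cos (U \<omega> + \<phi>))"
    using h by (intro integrable_mult_bounded) auto
  have "integrable M (\<lambda>\<omega>. h \<omega> * f \<omega>)"
    unfolding f_def right_diff_distrib using int1 h by simp
  with f f0 h(1) have "expectation (\<lambda>\<omega>. h \<omega> * f \<omega>) = 0"
    by (rule F.integral_mult_eq_0)
  then show ?thesis
    unfolding f_def right_diff_distrib using int1 h by (simp add: \<kappa>_def mult.commute)
qed

text \<open>Independence is now used with the roles exchanged: the weight is the centred indicator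
  of \<open>A\<close>, tested by trigonometric functions of \<open>U\<close>, hence by events of
  \<open>U\<close>, and finally by the unbounded variable \<open>U\<close> itself. The mean 0 of
  \<open>U\<close> removes the centring.\<close>

lemma expectation_indicator_uncorrelated:
  assumes I: "finite I" and x: "\<And>i. i \<in> I \<Longrightarrow> x i \<in> V" and U: "U \<in> H"
    and orth: "\<And>i v. i \<in> I \<Longrightarrow> expectation (\<lambda>\<omega>. U \<omega> * (v \<bullet> x i \<omega>)) = 0"
    and A: "A \<in> sets (generated_by M I x)"
  shows "expectation (\<lambda>\<omega>. U \<omega> * indicator A \<omega>) = 0"
proof -
  have Um: "U \<in> borel_measurable M" using U by (rule lin_functionals_measurable)
  have AM: "A \<in> events"
    using A subalgebra_generated_by[of I x M, OF lin_span_measurable[OF x]]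
    unfolding subalgebra_def by blast
  let ?f = "\<lambda>\<omega>. indicator A \<omega> - prob A"
  have f: "integrable M ?f" using integrable_indicator_event[OF AM] by simp
  have cos0: "expectation (\<lambda>\<omega>. ?f \<omega> * cos (s * U \<omega> + \<phi>)) = 0" for s \<phi>
  proof -
    have sU: "(\<lambda>\<omega>. s * U \<omega>) \<in> H" using U by (rule lin_functionals_cmult)
    have sorth: "expectation (\<lambda>\<omega>. (s * U \<omega>) * (v \<bullet> x i \<omega>)) = 0" if "i \<in> I" for i v
      using orth[OF that, of v] by (simp add: mult.assoc)
    have hA: "indicator A \<in> borel_measurable (generated_by M I x)" using A by simp
    have "expectation (\<lambda>\<omega>. indicator A \<omega> * cos (s * U \<omega> + \<phi>))
        = expectation (indicator A) * expectation (\<lambda>\<omega>. cos (s * U \<omega> + \<phi>))"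
      using I x sU sorth hA integrable_indicator_event[OF AM]
      by (rule expectation_mult_cos_uncorrelated)
    moreover have "integrable M (\<lambda>\<omega>. cos (s * U \<omega> + \<phi>))"
      using Um by (intro integrable_const_bound[where B = 1]) auto
    moreover have "integrable M (\<lambda>\<omega>. indicator A \<omega> * cos (s * U \<omega> + \<phi>))"
      using Um AM by (intro integrable_mult_bounded integrable_indicator_event) auto
    ultimately show ?thesis
      using AM by (simp add: left_diff_distrib)
  qed
  have ind0: "expectation (\<lambda>\<omega>. ?f \<omega> * indicator B (U \<omega>)) = 0" if "B \<in> sets borel" for B
  proof (rule integral_indicator_eq_0_if_trig_integrals_eq_0[OF f Um _ _ that])
    fix s
    show "expectation (\<lambda>\<omega>. ?f \<omega> * cos (s * U \<omega>)) = 0" using cos0[of s 0] by simp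
    have "cos (t - pi / 2) = sin t" for t :: real by (simp add: cos_diff)
    with cos0[of s "- pi / 2"] show "expectation (\<lambda>\<omega>. ?f \<omega> * sin (s * U \<omega>)) = 0" by simp
  qed
  interpret S: sigma_finite_subalgebra M "vimage_algebra (space M) U borel"
    using Um by (intro sigma_finite_subalgebraI subalgebra_vimage_algebra)
  have intA: "integrable M (\<lambda>\<omega>. U \<omega> * indicator A \<omega>)"
    using AM by (intro integrable_mult_bounded functional_integrable U) (auto simp: indicator_abs_le_1)
  have "expectation (\<lambda>\<omega>. U \<omega> * ?f \<omega>) = 0"
  proof (rule S.integral_mult_eq_0[OF f])
    show "U \<in> borel_measurable (vimage_algebra (space M) U borel)"
      by (rule measurable_vimage_algebra1) simp
    show "integrable M (\<lambda>\<omega>. U \<omega> * ?f \<omega>)"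
      unfolding right_diff_distrib using intA functional_integrable[OF U] by simp
    fix D assume "D \<in> sets (vimage_algebra (space M) U borel)"
    then obtain B where B: "B \<in> sets borel" "D = U -` B \<inter> space M"
      by (auto simp: sets_vimage_algebra2)
    have "expectation (\<lambda>\<omega>. ?f \<omega> * indicator D \<omega>) = expectation (\<lambda>\<omega>. ?f \<omega> * indicator B (U \<omega>))"
      by (intro Bochner_Integration.integral_cong refl) (auto simp: B indicator_def)
    with ind0[OF B(1)] show "expectation (\<lambda>\<omega>. ?f \<omega> * indicator D \<omega>) = 0" by simp
  qed
  then show ?thesis
    unfolding right_diff_distrib using intA functional_integrable[OF U] functional_expectation[OF U]
    by simp
qed

text \<open>Tested against a cosine of \<open>y\<close>, the weight \<open>g\<close> meets a
  regression part \<open>W\<close>, measurable for the smaller sigma-algebra, and an error part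
  \<open>U\<close>, independent of the larger one. The addition formula separates them; the error
  factors out, and what remains is 0 because \<open>g\<close> is orthogonal to functions of
  \<open>W\<close>.\<close>

lemma cond_cdf_eq_if_regression:
  assumes I: "finite I" and J: "J \<subseteq> I" and x: "\<And>i. i \<in> I \<Longrightarrow> x i \<in> V" and e: "e \<in> V"
    and y: "y \<in> borel_measurable M" and reg: "AE \<omega> in M. y \<omega> = (\<Sum>j\<in>J. B j *v x j \<omega>) + e \<omega>"
    and orth: "\<And>i. i \<in> I \<Longrightarrow> uncorrelated M e (x i)"
  shows "AE \<omega> in M. cond_cdf M y I x c \<omega> = cond_cdf M y J x c \<omega>"
proof -
  let ?F = "generated_by M I x" and ?G = "generated_by M J x"
  have MF: "subalgebra M ?F" using x by (intro subalgebra_generated_by lin_span_measurable)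
  have FG: "subalgebra ?F ?G" using J by (rule subalgebra_generated_by_mono)
  have MG: "subalgebra M ?G" using MF FG unfolding subalgebra_def by auto
  have FM: "A \<in> events" if "A \<in> sets ?F" for A using that MF by (auto simp: subalgebra_def)
  have "expectation (\<lambda>\<omega>. cond_residual M ?G A \<omega> * indicator D \<omega>) = 0"
    if A: "A \<in> sets ?F" and D: "D \<in> sets (vimage_algebra (space M) y borel)" for A D
  proof (rule integral_indicator_vimage_eq_0[OF _ y _ D])
    define g where "g = cond_residual M ?G A"
    note res = cond_residual[OF MG FM[OF A], folded g_def]
    show "integrable M (cond_residual M ?G A)" using res(1) by (simp add: g_def)
    have gF: "g \<in> borel_measurable ?F"
      unfolding g_def cond_residual_def[abs_def] using A measurable_from_subalg[OF FG borel_measurable_cond_exp]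
      by (intro borel_measurable_diff) auto
    fix a \<theta>
    define W where "W = (\<lambda>\<omega>. a \<bullet> (\<Sum>j\<in>J. B j *v x j \<omega>))"
    define U where "U = (\<lambda>\<omega>. a \<bullet> e \<omega>)"
    have U: "U \<in> H" unfolding U_def using e by (rule lin_spanD)
    have WG: "W \<in> borel_measurable ?G"
      unfolding W_def inner_sum_right dot_lmul_matrix[symmetric]
      by (intro borel_measurable_sum functional_measurable_generated_by)
    then have WF: "W \<in> borel_measurable ?F" by (rule measurable_from_subalg[OF FG])
    have WM: "W \<in> borel_measurable M" using WG by (rule measurable_from_subalg[OF MG])
    have UM: "U \<in> borel_measurable M" using U by (rule lin_functionals_measurable)
    have gM: "g \<in> borel_measurable M" using res(1) by auto
    have U_orth: "expectation (\<lambda>\<omega>. U \<omega> * (v \<bullet> x i \<omega>)) = 0" if "i \<in> I" for i v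
      using orth[OF that] unfolding U_def uncorrelated_def by blast
    \<comment> \<open>The addition formula needs both choices of \<open>T\<close>. The product
      \<open>T (W \<omega> + \<theta>) * g \<omega>\<close> is measurable for the larger
      sigma-algebra, as the independence of \<open>U\<close> demands.\<close>
    have zero: "expectation (\<lambda>\<omega>. (T (W \<omega> + \<theta>) * g \<omega>) * cos (U \<omega> + \<phi>)) = 0"
      and int: "integrable M (\<lambda>\<omega>. (T (W \<omega> + \<theta>) * g \<omega>) * cos (U \<omega> + \<phi>))"
      if T: "T = cos \<or> T = sin" for T :: "real \<Rightarrow> real" and \<phi>
    proof -
      have Tm: "(\<lambda>\<omega>. T (W \<omega> + \<theta>)) \<in> borel_measurable N" if "W \<in> borel_measurable N" for N
        using T that by auto
      have Tb: "\<bar>T s\<bar> \<le> 1" for s using T by auto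
      have h: "integrable M (\<lambda>\<omega>. T (W \<omega> + \<theta>) * g \<omega>)"
        by (rule integrable_mult_bounded(2)[OF res(1) Tm[OF WM]]) (simp add: Tb)
      then show "integrable M (\<lambda>\<omega>. (T (W \<omega> + \<theta>) * g \<omega>) * cos (U \<omega> + \<phi>))"
        by (rule integrable_mult_bounded(1)) (use UM in auto)
      have "integrable M (\<lambda>\<omega>. T (W \<omega> + \<theta>))"
        by (rule integrable_const_bound[where B = 1]) (use Tm[OF WM] Tb in auto)
      with Tm[OF WG] have mean: "expectation (\<lambda>\<omega>. T (W \<omega> + \<theta>) * g \<omega>) = 0" by (rule res(3))
      have "(\<lambda>\<omega>. T (W \<omega> + \<theta>) * g \<omega>) \<in> borel_measurable ?F"
        using Tm[OF WF] gF by (rule borel_measurable_times)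
      note expectation_mult_cos_uncorrelated[OF I x U U_orth this h, of \<phi>]
      with mean show "expectation (\<lambda>\<omega>. (T (W \<omega> + \<theta>) * g \<omega>) * cos (U \<omega> + \<phi>)) = 0"
        by simp
    qed
    \<comment> \<open>The sine of \<open>U\<close> is written as a cosine with phase
      \<open>pi / 2\<close>, so that both terms have the form treated in
      \<open>zero\<close>.\<close>
    have "AE \<omega> in M. g \<omega> * cos (a \<bullet> y \<omega> + \<theta>)
        = (cos (W \<omega> + \<theta>) * g \<omega>) * cos (U \<omega> + 0) + (sin (W \<omega> + \<theta>) * g \<omega>) * cos (U \<omega> + pi / 2)"
      using reg
    proof eventually_elim
      case (elim \<omega>)
      then have "a \<bullet> y \<omega> + \<theta> = (W \<omega> + \<theta>) + U \<omega>" by (simp add: W_def U_def inner_add_right)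
      then have eq1: "cos (a \<bullet> y \<omega> + \<theta>) = cos (W \<omega> + \<theta>) * cos (U \<omega>) - sin (W \<omega> + \<theta>) * sin (U \<omega>)"
        by (simp only: cos_add)
      have eq2: "cos (U \<omega> + pi / 2) = - sin (U \<omega>)" by (simp add: cos_add)
      show ?case unfolding eq1 eq2 by (simp add: algebra_simps)
    qed
    then have "expectation (\<lambda>\<omega>. g \<omega> * cos (a \<bullet> y \<omega> + \<theta>))
        = expectation (\<lambda>\<omega>. (cos (W \<omega> + \<theta>) * g \<omega>) * cos (U \<omega> + 0) + (sin (W \<omega> + \<theta>) * g \<omega>) * cos (U \<omega> + pi / 2))"
      by (rule integral_cong_AE[rotated 2]) (use gM WM UM y in measurable)
    also have "\<dots> = 0"
      using zero[of cos 0] zero[of sin "pi / 2"] int[of cos 0] int[of sin "pi / 2"]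
      by (subst Bochner_Integration.integral_add) auto
    finally show "expectation (\<lambda>\<omega>. cond_residual M ?G A \<omega> * cos (a \<bullet> y \<omega> + \<theta>)) = 0"
      by (simp add: g_def)
  qed
  then show ?thesis
    unfolding cond_cdf_def using real_cond_exp_atMost_eq_iff[OF MF FG y] by blast
qed

text \<open>The indicator of an event \<open>A\<close> of the larger sigma-algebra is split into its
  residual \<open>g\<close> and its conditional probability given the smaller one. Against
  \<open>g\<close>, the part \<open>Y\<close> gives 0 by the equality of distribution functions and
  the part \<open>W\<close> by measurability; against the conditional probability, \<open>U\<close>
  gives 0 because it is independent of the regressors. So \<open>U\<close> integrates to 0 over all
  such events, hence against every functional of \<open>x i\<close>.\<close>

lemma uncorrelated_if_cond_cdf_eq:
  assumes I: "finite I" and J: "J \<subseteq> I" and x: "\<And>i. i \<in> I \<Longrightarrow> x i \<in> V" and y: "y \<in> V"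
    and cdf: "\<And>c. AE \<omega> in M. cond_cdf M y I x c \<omega> = cond_cdf M y J x c \<omega>"
    and orth: "\<And>j. j \<in> J \<Longrightarrow> uncorrelated M (\<lambda>\<omega>. y \<omega> - (\<Sum>j\<in>J. B j *v x j \<omega>)) (x j)"
    and i: "i \<in> I"
  shows "uncorrelated M (\<lambda>\<omega>. y \<omega> - (\<Sum>j\<in>J. B j *v x j \<omega>)) (x i)"
  unfolding uncorrelated_def
proof (intro allI)
  fix u v
  let ?F = "generated_by M I x" and ?G = "generated_by M J x"
  have xJ: "x j \<in> V" if "j \<in> J" for j using that J x by blast
  have fJ: "finite J" using J I by (rule finite_subset)
  have ym: "y \<in> borel_measurable M" using y by (rule lin_span_measurable)
  have MF: "subalgebra M ?F" using x by (intro subalgebra_generated_by lin_span_measurable)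
  have FG: "subalgebra ?F ?G" using J by (rule subalgebra_generated_by_mono)
  have MG: "subalgebra M ?G" using MF FG unfolding subalgebra_def by auto
  interpret F: sigma_finite_subalgebra M ?F using MF by (rule sigma_finite_subalgebraI)
  interpret G: sigma_finite_subalgebra M ?G using MG by (rule sigma_finite_subalgebraI)
  interpret S: sigma_finite_subalgebra M "vimage_algebra (space M) y borel"
    using ym by (intro sigma_finite_subalgebraI subalgebra_vimage_algebra)
  define W where "W = (\<lambda>\<omega>. u \<bullet> (\<Sum>j\<in>J. B j *v x j \<omega>))"
  define Y where "Y = (\<lambda>\<omega>. u \<bullet> y \<omega>)"
  define U where "U = (\<lambda>\<omega>. Y \<omega> - W \<omega>)"
  have U_eq: "u \<bullet> (y \<omega> - (\<Sum>j\<in>J. B j *v x j \<omega>)) = U \<omega>" for \<omega>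
    by (simp add: U_def Y_def W_def inner_diff_right)
  have W: "W \<in> H" unfolding W_def by (intro lin_spanD lin_span_sum lin_span_matrix xJ)
  have Y: "Y \<in> H" unfolding Y_def using y by (rule lin_spanD)
  have U: "U \<in> H" unfolding U_def using Y W by (rule lin_functionals_diff)
  have UJ: "expectation (\<lambda>\<omega>. U \<omega> * (v \<bullet> x j \<omega>)) = 0" if "j \<in> J" for j v
    using orth[OF that, unfolded uncorrelated_def, rule_format, of u v] unfolding U_eq .
  have WG: "W \<in> borel_measurable ?G"
    unfolding W_def inner_sum_right dot_lmul_matrix[symmetric]
    by (intro borel_measurable_sum functional_measurable_generated_by)
  have indep: "expectation (\<lambda>\<omega>. U \<omega> * indicator A \<omega>) = 0" if A: "A \<in> sets ?F" for A
  proof -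
    have AM: "A \<in> events" using A MF by (auto simp: subalgebra_def)
    define g where "g = cond_residual M ?G A"
    note res = cond_residual[OF MG AM, folded g_def]
    let ?E = "real_cond_exp M ?G (indicator A)"
    have gM: "g \<in> borel_measurable M" using res(1) by auto
    have intg: "integrable M (\<lambda>\<omega>. Z \<omega> * g \<omega>)" if "Z \<in> H" for Z
      using functional_integrable[OF that] gM res(2) by (rule integrable_mult_bounded(1))
    have gD: "expectation (\<lambda>\<omega>. g \<omega> * indicator D \<omega>) = 0"
      if "D \<in> sets (vimage_algebra (space M) y borel)" for D
      using real_cond_exp_atMost_eq_iff[OF MF FG ym] cdf A that unfolding g_def cond_cdf_def by blast
    have "Y \<in> borel_measurable (vimage_algebra (space M) y borel)"
    proof -
      have "y \<in> vimage_algebra (space M) y borel \<rightarrow>\<^sub>M borel" by (rule measurable_vimage_algebra1) simp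
      then show ?thesis unfolding Y_def by simp
    qed
    from res(1) gD this intg[OF Y] have "expectation (\<lambda>\<omega>. Y \<omega> * g \<omega>) = 0"
      by (rule S.integral_mult_eq_0)
    moreover have "expectation (\<lambda>\<omega>. W \<omega> * g \<omega>) = 0"
      using WG functional_integrable[OF W] by (rule res(3))
    ultimately have Ug: "expectation (\<lambda>\<omega>. U \<omega> * g \<omega>) = 0"
      unfolding U_def left_diff_distrib using intg[OF Y] intg[OF W] by simp
    have intA: "integrable M (\<lambda>\<omega>. U \<omega> * indicator A \<omega>)"
      using AM by (intro integrable_mult_bounded functional_integrable U) (auto simp: indicator_abs_le_1)
    have eq: "?E \<omega> * U \<omega> = U \<omega> * indicator A \<omega> - U \<omega> * g \<omega>" for \<omega>
      by (simp add: g_def cond_residual_def algebra_simps)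
    have "expectation (\<lambda>\<omega>. ?E \<omega> * U \<omega>) = 0"
    proof (rule G.integral_mult_eq_0)
      show "integrable M U" using U by (rule functional_integrable)
      show "integrable M (\<lambda>\<omega>. ?E \<omega> * U \<omega>)"
        unfolding eq using intA intg[OF U] by (rule Bochner_Integration.integrable_diff)
      show "expectation (\<lambda>\<omega>. U \<omega> * indicator A \<omega>) = 0" if "A \<in> sets ?G" for A
        using fJ xJ U UJ that by (rule expectation_indicator_uncorrelated)
    qed simp
    then show ?thesis
      unfolding eq using Ug intA intg[OF U] by simp
  qed
  have vH: "(\<lambda>\<omega>. v \<bullet> x i \<omega>) \<in> H" using x[OF i] by (rule lin_spanD)
  have "expectation (\<lambda>\<omega>. (v \<bullet> x i \<omega>) * U \<omega>) = 0"
    using functional_integrable[OF U] indep functional_measurable_generated_by[OF i]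
      functional_integrable_mult[OF vH U] by (rule F.integral_mult_eq_0)
  then show "expectation (\<lambda>\<omega>. (u \<bullet> (y \<omega> - (\<Sum>j\<in>J. B j *v x j \<omega>))) * (v \<bullet> x i \<omega>)) = 0"
    unfolding U_eq by (simp add: mult.commute)
qed

end

section \<open>From the waypoint property to the representation\<close>

lemma sum_matrix_vector_mult: "(\<Sum>j\<in>J. A j) *v (v :: real ^ 'n) = (\<Sum>j\<in>J. A j *v v)"
  by (induction J rule: infinite_finite_induct) (auto simp: matrix_vector_mult_add_rdistrib)

section \<open>Consequences of a nonsingular stacked covariance\<close>

locale nonsingular_gaussian = gaussian_family M "{0..N}" x
  for M :: "'a measure" and N :: nat and x :: "nat \<Rightarrow> 'a \<Rightarrow> real ^ 'd" +
  assumes nonsingular: "block_nonsingular N (\<lambda>k l. Cov M (x k) (x l))"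
begin

abbreviation "L \<equiv> {0..N}"

lemma x_in_V: "k \<in> L \<Longrightarrow> x k \<in> V"
  by (intro lin_span_base z_measurable finite_L)

text \<open>Multiplying the relation by functionals of each \<open>x l\<close> and taking
  expectations shows that the block row \<open>a\<close> annihilates the covariance; applying column
  \<open>k\<close> of the block inverse isolates \<open>a k\<close>.\<close>

lemma nonsingular_no_relation:
  assumes rel: "AE \<omega> in M. (\<Sum>i\<in>L. a i \<bullet> x i \<omega>) = 0" and k: "k \<in> L"
  shows "a k = 0"
proof -
  have xH: "(\<lambda>\<omega>. v \<bullet> x i \<omega>) \<in> H" if "i \<in> L" for i v using x_in_V[OF that] by (rule lin_spanD)
  have orth: "(\<Sum>i\<in>L. a i \<bullet> (Cov M (x i) (x l) *v w)) = 0" if l: "l \<in> L" for l w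
  proof -
    have "(\<Sum>i\<in>L. a i \<bullet> (Cov M (x i) (x l) *v w))
        = (\<Sum>i\<in>L. expectation (\<lambda>\<omega>. (a i \<bullet> x i \<omega>) * (w \<bullet> x l \<omega>)))"
      using x_in_V l by (intro sum.cong refl Cov_bilinear) auto
    also have "\<dots> = expectation (\<lambda>\<omega>. \<Sum>i\<in>L. (a i \<bullet> x i \<omega>) * (w \<bullet> x l \<omega>))"
      using functional_integrable_mult[OF xH xH[OF l]]
      by (rule Bochner_Integration.integral_sum[symmetric])
    also have "\<dots> = 0"
    proof (rule integral_eq_zero_AE)
      show "AE \<omega> in M. (\<Sum>i\<in>L. (a i \<bullet> x i \<omega>) * (w \<bullet> x l \<omega>)) = 0"
        using rel by eventually_elim (simp flip: sum_distrib_right)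
    qed
    finally show ?thesis .
  qed
  obtain B where B: "\<And>i k. i \<in> L \<Longrightarrow> k \<in> L \<Longrightarrow>
      (\<Sum>j\<in>L. Cov M (x i) (x j) ** B j k) = (if i = k then mat 1 else 0)"
    using nonsingular unfolding block_nonsingular_def by blast
  have "a k \<bullet> v = 0" for v
  proof -
    have "a k \<bullet> v = (\<Sum>i\<in>L. if i = k then a i \<bullet> v else 0)"
      using k by simp
    also have "\<dots> = (\<Sum>i\<in>L. a i \<bullet> ((\<Sum>j\<in>L. Cov M (x i) (x j) ** B j k) *v v))"
      using k by (intro sum.cong refl) (simp add: B)
    also have "\<dots> = (\<Sum>i\<in>L. \<Sum>j\<in>L. a i \<bullet> (Cov M (x i) (x j) *v (B j k *v v)))"
      by (simp add: sum_matrix_vector_mult inner_sum_right matrix_vector_mul_assoc)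
    also have "\<dots> = (\<Sum>j\<in>L. \<Sum>i\<in>L. a i \<bullet> (Cov M (x i) (x j) *v (B j k *v v)))"
      by (rule sum.swap)
    also have "\<dots> = 0" using orth by (intro sum.neutral) blast
    finally show ?thesis .
  qed
  from this[of "a k"] show ?thesis by simp
qed

text \<open>A vector \<open>v\<close> in the kernel makes \<open>v \<bullet> e\<close> vanish almost
  surely, which is a linear relation among the \<open>x i\<close>. Its coefficient at
  \<open>k\<close> is \<open>v\<close> itself, because \<open>k\<close> is not among the regressors;
  so \<open>v\<close> is 0.\<close>

lemma invertible_Cov_residual:
  assumes k: "k \<in> L" and J: "J \<subseteq> L" "k \<notin> J"
    and e: "\<And>\<omega>. e \<omega> = x k \<omega> - (\<Sum>j\<in>J. B j *v x j \<omega>)"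
  shows "invertible (Cov M e e)"
proof -
  have "(\<lambda>\<omega>. x k \<omega> - (\<Sum>j\<in>J. B j *v x j \<omega>)) \<in> V"
    using k J(1) by (intro lin_span_diff lin_span_sum lin_span_matrix x_in_V) blast+
  then have eV: "e \<in> V" by (simp add: e[abs_def])
  have "v = 0" if v: "Cov M e e *v v = 0" for v
  proof -
    have vH: "(\<lambda>\<omega>. v \<bullet> e \<omega>) \<in> H" using eV by (rule lin_spanD)
    have "expectation (\<lambda>\<omega>. (v \<bullet> e \<omega>) * (v \<bullet> e \<omega>)) = 0"
      using Cov_bilinear[OF eV eV, of v v] v by simp
    then have "AE \<omega> in M. (v \<bullet> e \<omega>) * (v \<bullet> e \<omega>) = 0"
      by (subst (asm) integral_nonneg_eq_0_iff_AE[OF functional_integrable_mult[OF vH vH]]) auto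
    then have "AE \<omega> in M. v \<bullet> e \<omega> = 0" by eventually_elim simp
    moreover define a where "a = (\<lambda>i. if i = k then v else if i \<in> J then - (v v* B i) else 0)"
    have "v \<bullet> e \<omega> = (\<Sum>i\<in>L. a i \<bullet> x i \<omega>)" for \<omega>
    proof -
      have "(\<Sum>i\<in>L. a i \<bullet> x i \<omega>) = a k \<bullet> x k \<omega> + (\<Sum>i\<in>L - {k}. a i \<bullet> x i \<omega>)"
        using k by (simp add: sum.remove)
      also have "(\<Sum>i\<in>L - {k}. a i \<bullet> x i \<omega>) = (\<Sum>i\<in>J. a i \<bullet> x i \<omega>)"
        using J finite_L by (intro sum.mono_neutral_right) (auto simp: a_def)
      also have "\<dots> = (\<Sum>i\<in>J. - (v \<bullet> (B i *v x i \<omega>)))"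
        using J(2) by (intro sum.cong refl) (auto simp: a_def dot_lmul_matrix)
      finally show ?thesis
        by (simp add: e a_def inner_diff_right inner_sum_right sum_negf)
    qed
    ultimately have "AE \<omega> in M. (\<Sum>i\<in>L. a i \<bullet> x i \<omega>) = 0" by simp
    from nonsingular_no_relation[OF this k] show "v = 0" by (simp add: a_def)
  qed
  then show ?thesis
    by (simp add: invertible_left_inverse matrix_left_invertible_ker)
qed

end

section \<open>Sections between waypoints and the order of the innovations\<close>

locale waypoints =
  fixes T :: "nat \<Rightarrow> nat" and m N :: nat
  assumes T_0: "T 0 = 0" and T_strict_mono: "strict_mono_on {0..m} T" and T_m: "T m = N"
begin

lemma T_less: "i < j \<Longrightarrow> j \<le> m \<Longrightarrow> T i < T j"
  using T_strict_mono by (auto simp: strict_mono_on_def)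

lemma T_le: "i \<le> j \<Longrightarrow> j \<le> m \<Longrightarrow> T i \<le> T j"
  using T_less[of i j] by (cases "i = j") auto

lemma T_le_N: "j \<le> m \<Longrightarrow> T j \<le> N"
  using T_le[of j m] T_m by simp

text \<open>Section \<open>n\<close> consists of the times after \<open>T (n - 1)\<close> up to and
  including \<open>T n\<close>, so a waypoint belongs to the section that it closes. Time 0 precedes
  all sections and gets the value 0.\<close>

definition sec :: "nat \<Rightarrow> nat" where
  "sec k = (LEAST n. k \<le> T n)"

lemma sec_eqI:
  assumes "n \<in> {1..m}" "T (n - 1) < k" "k \<le> T n"
  shows "sec k = n"
  unfolding sec_def
proof (rule Least_equality)
  fix n' assume "k \<le> T n'"
  show "n \<le> n'"
  proof (rule ccontr)
    assume "\<not> n \<le> n'"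
    then have "T n' \<le> T (n - 1)" using assms(1) by (intro T_le) auto
    with \<open>k \<le> T n'\<close> assms(2) show False by simp
  qed
qed (use assms in simp)

lemma sec:
  assumes "k \<in> {1..N}"
  shows "sec k \<in> {1..m}" "T (sec k - 1) < k" "k \<le> T (sec k)"
proof -
  have ex: "k \<le> T m" using assms T_m by simp
  show le: "k \<le> T (sec k)" unfolding sec_def using ex by (rule LeastI)
  have "sec k \<le> m" unfolding sec_def using ex by (rule Least_le)
  moreover have "sec k \<noteq> 0" using le assms T_0 by (intro notI) simp
  ultimately show "sec k \<in> {1..m}" by simp
  then have "\<not> k \<le> T (sec k - 1)" using not_less_Least[of "sec k - 1" "\<lambda>n. k \<le> T n"]
    by (simp add: sec_def)
  then show "T (sec k - 1) < k" by simp
qed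

text \<open>\<open>past k\<close> is the set of times the innovation at \<open>k\<close> has to be uncorrelated with, and
  \<open>parents k\<close> the set of times occurring on the right-hand side of the equation for \<open>x k\<close>.\<close>

definition past :: "nat \<Rightarrow> nat set" where
  "past k = (if k = T (sec k) then {0..T (sec k - 1)} else {0..k - 1} \<union> {T (sec k)})"

definition parents :: "nat \<Rightarrow> nat set" where
  "parents k = (if k = T (sec k) then {T (sec k - 1)} else {k - 1, T (sec k)})"

lemma parents_past:
  assumes "k \<in> {1..N}"
  shows "parents k \<subseteq> past k" "past k \<subseteq> {0..N}" "k \<notin> past k" "0 \<in> past k" "finite (past k)"
  using sec[OF assms] T_le_N[of "sec k"] T_le_N[of "sec k - 1"] assms
  by (auto simp: parents_def past_def)

text \<open>For any two innovations, the variables defining one lie in the past of the other, and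
  this is what whiteness requires. The later time usually has the larger past; the exception is a
  pair inside one section where \<open>l\<close> is the closing waypoint, since that waypoint
  already belongs to the past of \<open>k\<close>.\<close>

lemma parents_before:
  assumes k: "k \<in> {1..N}" and l: "l \<in> {1..N}" and "k < l"
  shows "insert k (parents k) \<subseteq> past l \<or> insert l (parents l) \<subseteq> past k"
proof -
  note sk = sec[OF k] and sl = sec[OF l]
  have "sec k \<le> sec l"
    using \<open>k < l\<close> sl(3) unfolding sec_def[of k] by (intro Least_le) simp
  then consider "sec k < sec l" | "sec k = sec l" by linarith
  then show ?thesis
  proof cases
    case 1
    then have "T (sec k) \<le> T (sec l - 1)" using sl(1) by (intro T_le) auto
    then have "insert k (parents k) \<subseteq> past l"
      using sk sl by (auto simp: parents_def past_def)
    then show ?thesis ..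
  next
    case 2
    then show ?thesis
      using sk sl \<open>k < l\<close> by (auto simp: parents_def past_def)
  qed
qed

end

section \<open>Innovations as residuals of the regression on the parents\<close>

locale gaussian_waypoints = waypoints T m N + nonsingular_gaussian M N x
  for T m N and M :: "'a measure" and x :: "nat \<Rightarrow> 'a \<Rightarrow> real ^ 'd"
begin

lemma cond_cdf_past_eq:
  assumes CM: "waypoint_CM M m T x" and k: "k \<in> {1..N}"
  shows "AE \<omega> in M. cond_cdf M (x k) (past k) x c \<omega> = cond_cdf M (x k) (parents k) x c \<omega>"
proof (cases "k = T (sec k)")
  case True
  have "sec k - 1 < sec k" using sec(1)[OF k] by simp
  with CM sec(1)[OF k] have "AE \<omega> in M. cond_cdf M (x (T (sec k))) {0..T (sec k - 1)} x c \<omega>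
      = cond_cdf M (x (T (sec k))) {T (sec k - 1)} x c \<omega>"
    unfolding waypoint_CM_def by blast
  then show ?thesis unfolding past_def parents_def if_P[OF True] by (subst True, subst (2) True)
next
  case False
  then have "T (sec k - 1) \<le> k - 1 \<and> k - 1 < k \<and> k < T (sec k)" using sec[OF k] k by auto
  with CM sec(1)[OF k] have "AE \<omega> in M. cond_cdf M (x k) ({0..k - 1} \<union> {T (sec k)}) x c \<omega>
      = cond_cdf M (x k) {k - 1, T (sec k)} x c \<omega>"
    unfolding waypoint_CM_def by blast
  then show ?thesis unfolding past_def parents_def if_not_P[OF False] .
qed

lemma representation_if_waypoint_CM:
  assumes CM: "waypoint_CM M m T x"
  obtains G e where
    "\<And>n k. n \<in> {1..m} \<Longrightarrow> k \<in> {T (n - 1) + 1..T n - 1} \<Longrightarrow>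
       AE \<omega> in M. x k \<omega> = G k (k - 1) *v x (k - 1) \<omega> + G k (T n) *v x (T n) \<omega> + e k \<omega>"
    and "\<And>n. n \<in> {1..m} \<Longrightarrow>
       AE \<omega> in M. x (T n) \<omega> = G (T n) (T (n - 1)) *v x (T (n - 1)) \<omega> + e (T n) \<omega>"
    and "zero_mean_white_gaussian M {1..N} e"
    and "\<And>k. k \<in> {1..N} \<Longrightarrow> invertible (Cov M (e k) (e k))"
    and "jointly_gaussian M {0..N} (e(0 := x 0))"
    and "\<And>k. k \<in> {1..N} \<Longrightarrow> Cov M (e k) (x 0) = 0"
proof -
  have "\<exists>B. \<forall>i\<in>past k. uncorrelated M (\<lambda>\<omega>. x k \<omega> - (\<Sum>j\<in>parents k. B j *v x j \<omega>)) (x i)"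
    if k: "k \<in> {1..N}" for k
  proof -
    note pp = parents_past[OF k]
    have past: "x i \<in> V" if "i \<in> past k" for i using that pp(2) by (intro x_in_V) blast
    have parents: "x i \<in> V" if "i \<in> parents k" for i using that pp(1) past by blast
    have xk: "x k \<in> V" using k by (intro x_in_V) simp
    obtain B where "\<forall>j\<in>parents k. uncorrelated M (\<lambda>\<omega>. x k \<omega> - (\<Sum>j\<in>parents k. B j *v x j \<omega>)) (x j)"
      using vector_regression[where x = x, OF finite_subset[OF pp(1,5)] parents xk] by blast
    then have B: "uncorrelated M (\<lambda>\<omega>. x k \<omega> - (\<Sum>j\<in>parents k. B j *v x j \<omega>)) (x j)" if "j \<in> parents k" for j
      using that ..
    \<comment> \<open>Regression provides orthogonality to the parents; equality of the conditional
      distribution functions extends it to the whole past.\<close>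
    show ?thesis
      using uncorrelated_if_cond_cdf_eq[where x = x, OF pp(5,1) past xk cond_cdf_past_eq[OF CM k] B] by blast
  qed
  then have "\<forall>k\<in>{1..N}. \<exists>B. \<forall>i\<in>past k. uncorrelated M (\<lambda>\<omega>. x k \<omega> - (\<Sum>j\<in>parents k. B j *v x j \<omega>)) (x i)" ..
  from bchoice[OF this] obtain G where G: "\<forall>k\<in>{1..N}. \<forall>i\<in>past k.
      uncorrelated M (\<lambda>\<omega>. x k \<omega> - (\<Sum>j\<in>parents k. G k j *v x j \<omega>)) (x i)" ..
  define e where "e = (\<lambda>k \<omega>. x k \<omega> - (\<Sum>j\<in>parents k. G k j *v x j \<omega>))"
  have orth: "uncorrelated M (e k) (x i)" if "k \<in> {1..N}" "i \<in> past k" for k i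
    using G that unfolding e_def by blast
  have span: "e k \<in> lin_span M (insert k (parents k)) x" if k: "k \<in> {1..N}" for k
  proof -
    have sub: "insert k (parents k) \<subseteq> {0..N}" using parents_past[OF k] k by auto
    have "x i \<in> lin_span M (insert k (parents k)) x" if "i \<in> insert k (parents k)" for i
    proof (rule lin_span_base[OF finite_subset[OF sub] that])
      show "x i \<in> borel_measurable M" using that sub by (intro z_measurable) blast
    qed simp
    then show ?thesis unfolding e_def by (intro lin_span_diff lin_span_sum lin_span_matrix) auto
  qed
  have eV: "e k \<in> V" if k: "k \<in> {1..N}" for k
  proof (rule lin_span_trans[OF span[OF k]])
    show "x i \<in> V" if "i \<in> insert k (parents k)" for i
      using that parents_past[OF k] k by (intro x_in_V) auto
  qed
  \<comment> \<open>\<open>e l\<close> is a combination of \<open>x l\<close> and the parents of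
    \<open>l\<close>, so orthogonality of \<open>e k\<close> to these variables suffices.\<close>
  have cross: "uncorrelated M (e k) (e l)"
    if k: "k \<in> {1..N}" and l: "l \<in> {1..N}" and sub: "insert l (parents l) \<subseteq> past k" for k l
  proof (rule uncorrelated_span[OF eV[OF k] _ span[OF l]])
    fix i assume "i \<in> insert l (parents l)"
    then have "i \<in> past k" using sub by blast
    then show "x i \<in> V" "uncorrelated M (e k) (x i)"
      using parents_past(2)[OF k] orth[OF k] by (auto intro: x_in_V)
  qed
  have white: "uncorrelated M (e k) (e l)" if k: "k \<in> {1..N}" and l: "l \<in> {1..N}" and "k \<noteq> l" for k l
  proof (cases "k < l")
    case True
    then show ?thesis
      using parents_before[OF k l] cross[OF k l] uncorrelated_sym[OF cross[OF l k]] by blast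
  next
    case False
    with \<open>k \<noteq> l\<close> have "l < k" by simp
    then show ?thesis
      using parents_before[OF l k] cross[OF k l] uncorrelated_sym[OF cross[OF l k]] by blast
  qed
  show thesis
  proof (rule that[of G e])
    fix n k assume n: "n \<in> {1..m}" and k: "k \<in> {T (n - 1) + 1..T n - 1}"
    then have s: "sec k = n" by (intro sec_eqI) auto
    \<comment> \<open>The first inequality selects the interior form of \<open>parents\<close>; the
      second makes its two elements distinct, so that the sum has two terms.\<close>
    have "k \<noteq> T n" "k - 1 \<noteq> T n" using k by auto
    then have "x k \<omega> = G k (k - 1) *v x (k - 1) \<omega> + G k (T n) *v x (T n) \<omega> + e k \<omega>" for \<omega>
      by (simp add: e_def parents_def s)
    then show "AE \<omega> in M. x k \<omega> = G k (k - 1) *v x (k - 1) \<omega> + G k (T n) *v x (T n) \<omega> + e k \<omega>"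
      by simp
  next
    fix n assume n: "n \<in> {1..m}"
    then have "sec (T n) = n" by (intro sec_eqI T_less) auto
    then show "AE \<omega> in M. x (T n) \<omega> = G (T n) (T (n - 1)) *v x (T (n - 1)) \<omega> + e (T n) \<omega>"
      by (simp add: e_def parents_def)
  next
    show "zero_mean_white_gaussian M {1..N} e"
      unfolding zero_mean_white_gaussian_def
      using jointly_gaussian_span[where Y = e, OF finite_atLeastAtMost eV] white Cov_eq_0_iff[OF eV eV]
      by blast
  next
    fix k assume k: "k \<in> {1..N}"
    show "invertible (Cov M (e k) (e k))"
    proof (rule invertible_Cov_residual)
      show "k \<in> {0..N}" using k by simp
      show "parents k \<subseteq> {0..N}" "k \<notin> parents k" using parents_past[OF k] by auto
      show "e k \<omega> = x k \<omega> - (\<Sum>j\<in>parents k. G k j *v x j \<omega>)" for \<omega> by (simp add: e_def)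
    qed
    \<comment> \<open>Time 0 lies in the past of every \<open>k\<close>, so this is one of the
      orthogonality relations already obtained.\<close>
    show "Cov M (e k) (x 0) = 0"
      using Cov_eq_0_iff[OF eV[OF k] x_in_V[of 0]] orth[OF k parents_past(4)[OF k]] by simp
  next
    show "jointly_gaussian M {0..N} (e(0 := x 0))"
      by (rule jointly_gaussian_span) (auto intro: x_in_V eV)
  qed
qed

end

section \<open>From the representation to the waypoint property\<close>

lemma lin_span_AE_eq:
  assumes "AE \<omega> in M. Y \<omega> = A *v W \<omega> + B *v W' \<omega> + R \<omega>" "Y \<in> borel_measurable M"
    and "W \<in> lin_span M I X" "W' \<in> lin_span M I X" "R \<in> lin_span M I X"
  shows "Y \<in> lin_span M I X"
  using lin_span_add[OF lin_span_add[OF lin_span_matrix[OF assms(3)] lin_span_matrix[OF assms(4)]] assms(5)]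
    assms(2,1)
  by (rule lin_span_AE_cong)

locale gaussian_waypoints_model = gaussian_waypoints T m N M x
  for T m N and M :: "'a measure" and x :: "nat \<Rightarrow> 'a \<Rightarrow> real ^ 'd" +
  fixes G :: "nat \<Rightarrow> nat \<Rightarrow> real ^ 'd ^ 'd" and e :: "nat \<Rightarrow> 'a \<Rightarrow> real ^ 'd"
  assumes between: "\<And>n k. n \<in> {1..m} \<Longrightarrow> k \<in> {T (n - 1) + 1..T n - 1} \<Longrightarrow>
       AE \<omega> in M. x k \<omega> = G k (k - 1) *v x (k - 1) \<omega> + G k (T n) *v x (T n) \<omega> + e k \<omega>"
    and waypoint: "\<And>n. n \<in> {1..m} \<Longrightarrow>
       AE \<omega> in M. x (T n) \<omega> = G (T n) (T (n - 1)) *v x (T (n - 1)) \<omega> + e (T n) \<omega>"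
    and white: "zero_mean_white_gaussian M {1..N} e"
    and initial: "\<And>k. k \<in> {1..N} \<Longrightarrow> Cov M (e k) (x 0) = 0"
begin

text \<open>With \<open>x 0\<close> in the free slot 0, the innovations become an orthogonal family
  indexed by all times, from which every \<open>x k\<close> is built.\<close>

definition z :: "nat \<Rightarrow> 'a \<Rightarrow> real ^ 'd" where
  "z = e(0 := x 0)"

lemma z_eq: "0 < k \<Longrightarrow> z k = e k"
  by (simp add: z_def)

text \<open>Solving the equation at time \<open>k\<close> for \<open>e k\<close> exhibits it as a
  linear function of the sequence, so the Gaussian calculus for \<open>x\<close> applies to the
  innovations.\<close>

lemma e_in_V:
  assumes k: "k \<in> {1..N}" shows "e k \<in> V"
proof -
  have em: "e k \<in> borel_measurable M"
    using white k by (simp add: zero_mean_white_gaussian_def jointly_gaussian_def)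
  note s = sec[OF k]
  have TN: "T (sec k) \<in> L" "T (sec k - 1) \<in> L" "k \<in> L" "k - 1 \<in> L"
    using s T_le_N[of "sec k"] T_le_N[of "sec k - 1"] k by auto
  show ?thesis
  proof (cases "k = T (sec k)")
    case True
    have "AE \<omega> in M. e k \<omega> = x k \<omega> - G k (T (sec k - 1)) *v x (T (sec k - 1)) \<omega>"
      using waypoint[OF s(1)] unfolding True[symmetric] by eventually_elim simp
    then show ?thesis
      by (rule lin_span_AE_cong[rotated 2]) (intro lin_span_diff lin_span_matrix x_in_V TN em)+
  next
    case False
    with s have "k \<in> {T (sec k - 1) + 1..T (sec k) - 1}" by auto
    from between[OF s(1) this]
    have "AE \<omega> in M. e k \<omega> = x k \<omega> - G k (k - 1) *v x (k - 1) \<omega> - G k (T (sec k)) *v x (T (sec k)) \<omega>"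
      by eventually_elim simp
    then show ?thesis
      by (rule lin_span_AE_cong[rotated 2]) (intro lin_span_diff lin_span_matrix x_in_V TN em)+
  qed
qed

lemma z_in_V: "k \<in> L \<Longrightarrow> z k \<in> V"
  using e_in_V[of k] x_in_V[of 0] by (cases "k = 0") (auto simp: z_def)

lemma z_uncorrelated:
  assumes "k \<in> L" "l \<in> L" "k \<noteq> l" shows "uncorrelated M (z k) (z l)"
proof -
  have ee: "uncorrelated M (e i) (e j)" if "i \<in> {1..N}" "j \<in> {1..N}" "i \<noteq> j" for i j
    using white that Cov_eq_0_iff[OF e_in_V e_in_V] by (simp add: zero_mean_white_gaussian_def)
  have e0: "uncorrelated M (e i) (x 0)" if "i \<in> {1..N}" for i
    using initial[OF that] Cov_eq_0_iff[OF e_in_V[OF that] x_in_V[of 0]] by simp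
  consider "k = 0" "l \<in> {1..N}" | "l = 0" "k \<in> {1..N}" | "k \<in> {1..N}" "l \<in> {1..N}"
    using assms by fastforce
  then show ?thesis
    by cases (use ee[of k l] e0 uncorrelated_sym[OF e0] assms(3) in \<open>simp_all add: z_def\<close>)
qed

text \<open>Bilinearity and orthogonality of the family \<open>z\<close>. From here on,
  uncorrelatedness is obtained by recording which innovations each vector uses.\<close>

lemma z_spans_uncorrelated:
  assumes "A \<inter> B = {}" "A \<subseteq> L" "B \<subseteq> L" and Y: "Y \<in> lin_span M A z" and W: "W \<in> lin_span M B z"
  shows "uncorrelated M Y W"
proof -
  have zV: "z i \<in> V" if "i \<in> A \<union> B" for i using that assms(2,3) by (intro z_in_V) blast
  have YV: "Y \<in> V" using Y by (rule lin_span_trans) (use zV in blast)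
  show ?thesis
  proof (rule uncorrelated_span[OF YV _ W])
    fix b assume b: "b \<in> B"
    show "z b \<in> V" using b zV by blast
    have "uncorrelated M (z b) Y"
    proof (rule uncorrelated_span[OF _ _ Y])
      show "z b \<in> V" using b zV by blast
      show "z a \<in> V" if "a \<in> A" for a using that zV by blast
      show "uncorrelated M (z b) (z a)" if "a \<in> A" for a
        using that b assms(1-3) by (intro z_uncorrelated) auto
    qed
    then show "uncorrelated M Y (z b)" by (rule uncorrelated_sym)
  qed
qed

lemma z_base: "i \<in> A \<Longrightarrow> A \<subseteq> L \<Longrightarrow> z i \<in> lin_span M A z"
  using finite_subset[of A L] by (intro lin_span_base lin_span_measurable[OF z_in_V]) auto

lemma z_mono: "Y \<in> lin_span M A z \<Longrightarrow> A \<subseteq> B \<Longrightarrow> B \<subseteq> L \<Longrightarrow> Y \<in> lin_span M B z"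
  using finite_subset[of B L] lin_span_measurable[OF z_in_V] by (intro lin_span_mono[of Y M A z B]) auto

lemma x_measurable: "k \<in> L \<Longrightarrow> x k \<in> borel_measurable M"
  by (rule z_measurable)

text \<open>The waypoint \<open>x (T n)\<close> comes first, because the interior equations refer to
  it. An interior \<open>x i\<close> then uses the innovations up to \<open>i\<close> and the one at
  \<open>T n\<close>, but none strictly between; this gap is what the Markov-type conclusion rests
  on.\<close>

lemma spans_within_section:
  assumes n: "n \<in> {1..m}" and start: "x (T (n - 1)) \<in> lin_span M {0..T (n - 1)} z"
  shows "x (T n) \<in> lin_span M ({0..T (n - 1)} \<union> {T n}) z"
    and "T (n - 1) \<le> i \<Longrightarrow> i < T n \<Longrightarrow> x i \<in> lin_span M ({0..i} \<union> {T n}) z"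
proof -
  have less: "T (n - 1) < T n" using n by (intro T_less) auto
  have TN: "T n \<le> N" using n by (intro T_le_N) simp
  show wp: "x (T n) \<in> lin_span M ({0..T (n - 1)} \<union> {T n}) z"
  \<comment> \<open>The waypoint equation has a single regressor; the second term is filled with
    zeros.\<close>
  proof (rule lin_span_AE_eq[where B = 0 and W' = "\<lambda>_. 0"])
    show "AE \<omega> in M. x (T n) \<omega> = G (T n) (T (n - 1)) *v x (T (n - 1)) \<omega> + 0 *v 0 + z (T n) \<omega>"
      using waypoint[OF n] less by (simp add: z_eq)
    show "x (T n) \<in> borel_measurable M" using TN by (intro x_measurable) simp
    show "x (T (n - 1)) \<in> lin_span M ({0..T (n - 1)} \<union> {T n}) z"
      using less TN by (intro z_mono[OF start]) auto
    show "z (T n) \<in> lin_span M ({0..T (n - 1)} \<union> {T n}) z"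
      using less TN by (intro z_base) auto
  qed (rule lin_span_0)
  show "x i \<in> lin_span M ({0..i} \<union> {T n}) z" if "T (n - 1) \<le> i" "i < T n"
    using that
  proof (induction i rule: dec_induct)
    case base
    then show ?case using less TN by (intro z_mono[OF start]) auto
  next
    case (step i)
    show ?case
    proof (rule lin_span_AE_eq)
      show "AE \<omega> in M. x (Suc i) \<omega> = G (Suc i) i *v x i \<omega> + G (Suc i) (T n) *v x (T n) \<omega> + z (Suc i) \<omega>"
        using between[OF n, of "Suc i"] step by (simp add: z_eq)
      show "x (Suc i) \<in> borel_measurable M" using step.prems TN by (intro x_measurable) simp
      have "x i \<in> lin_span M ({0..i} \<union> {T n}) z" using step by simp
      then show "x i \<in> lin_span M ({0..Suc i} \<union> {T n}) z"
        by (rule z_mono) (use step.prems TN in auto)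
      show "x (T n) \<in> lin_span M ({0..Suc i} \<union> {T n}) z"
        using wp by (rule z_mono) (use step TN in auto)
      show "z (Suc i) \<in> lin_span M ({0..Suc i} \<union> {T n}) z"
        using step.prems TN by (intro z_base) auto
    qed
  qed
qed

text \<open>The index set ends at a waypoint because an interior variable also uses the innovation
  of the waypoint ahead of it. Hence the induction runs over sections.\<close>

lemma spans_upto_waypoint:
  assumes "n \<le> m" "i \<le> T n"
  shows "x i \<in> lin_span M {0..T n} z"
  using assms
proof (induction n arbitrary: i)
  case 0
  have "x 0 = z 0" by (simp add: z_def)
  with 0 T_0 show ?case using z_base[of 0 "{0}"] by simp
next
  case (Suc n)
  have sn: "Suc n \<in> {1..m}" using Suc.prems by simp
  have less: "T n < T (Suc n)" and TN: "T (Suc n) \<le> N"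
    using Suc.prems by (auto intro: T_less T_le_N)
  have start: "x (T (Suc n - 1)) \<in> lin_span M {0..T (Suc n - 1)} z"
    using Suc.IH[of "T n"] Suc.prems by simp
  note in_section = spans_within_section[OF sn start]
  consider "i \<le> T n" | "T n < i" "i < T (Suc n)" | "i = T (Suc n)" using Suc.prems by linarith
  then show ?case
  proof cases
    case 1
    then have "x i \<in> lin_span M {0..T n} z" using Suc by simp
    then show ?thesis by (rule z_mono) (use less TN in auto)
  next
    case 2
    then have "x i \<in> lin_span M ({0..i} \<union> {T (Suc n)}) z" using in_section(2)[of i] by simp
    then show ?thesis by (rule z_mono) (use 2 TN in auto)
  next
    case 3
    show ?thesis unfolding 3 using in_section(1) by (rule z_mono) (use less TN in auto)
  qed
qed

text \<open>Only \<open>x k\<close> is expanded back to time \<open>j\<close>;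
  \<open>x (T n)\<close> is kept as a regressor and its coefficient accumulates. The remainder
  therefore involves innovations after \<open>j\<close> and up to \<open>k\<close> alone.\<close>

lemma iterate_within_section:
  assumes n: "n \<in> {1..m}" and j: "T (n - 1) \<le> j" and "j \<le> k" "k < T n"
  shows "\<exists>A B r. r \<in> lin_span M {j + 1..k} z \<and>
    (AE \<omega> in M. x k \<omega> = A *v x j \<omega> + B *v x (T n) \<omega> + r \<omega>)"
  using assms(3,4)
proof (induction k rule: dec_induct)
  case base
  have "AE \<omega> in M. x j \<omega> = mat 1 *v x j \<omega> + 0 *v x (T n) \<omega> + 0" by simp
  then show ?case using lin_span_0 by blast
next
  case (step k)
  have TN: "T n \<le> N" using n by (intro T_le_N) simp
  obtain A B r where r: "r \<in> lin_span M {j + 1..k} z"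
    and k: "AE \<omega> in M. x k \<omega> = A *v x j \<omega> + B *v x (T n) \<omega> + r \<omega>"
    using step by auto
  let ?G = "G (Suc k) k"
  have "AE \<omega> in M. x (Suc k) \<omega> = ?G *v x k \<omega> + G (Suc k) (T n) *v x (T n) \<omega> + z (Suc k) \<omega>"
    using between[OF n, of "Suc k"] step j by (simp add: z_eq)
  with k have "AE \<omega> in M. x (Suc k) \<omega> = (?G ** A) *v x j \<omega>
      + (?G ** B + G (Suc k) (T n)) *v x (T n) \<omega> + (?G *v r \<omega> + z (Suc k) \<omega>)"
    by eventually_elim
      (simp add: matrix_vector_right_distrib matrix_vector_mult_add_rdistrib matrix_vector_mul_assoc)
  moreover have "(\<lambda>\<omega>. ?G *v r \<omega> + z (Suc k) \<omega>) \<in> lin_span M {j + 1..Suc k} z"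
  proof (intro lin_span_add lin_span_matrix)
    show "r \<in> lin_span M {j + 1..Suc k} z"
      using r by (rule z_mono) (use step.prems TN in auto)
    show "z (Suc k) \<in> lin_span M {j + 1..Suc k} z"
      using step TN by (intro z_base) auto
  qed
  ultimately show ?case by blast
qed

text \<open>The remainder collects innovations at waypoints only. It is placed in the span over the
  whole interval after \<open>T h\<close>, which is already disjoint from the indices up to
  \<open>T h\<close>.\<close>

lemma iterate_waypoints:
  assumes "h \<le> n" "n \<le> m"
  shows "\<exists>A r. r \<in> lin_span M {T h + 1..T n} z \<and> (AE \<omega> in M. x (T n) \<omega> = A *v x (T h) \<omega> + r \<omega>)"
  using assms
proof (induction n rule: dec_induct)
  case base
  have "AE \<omega> in M. x (T h) \<omega> = mat 1 *v x (T h) \<omega> + 0" by simp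
  then show ?case using lin_span_0 by blast
next
  case (step n)
  have less: "T n < T (Suc n)" and TN: "T (Suc n) \<le> N" and hn: "T h \<le> T n"
    using step by (auto intro: T_less T_le_N T_le)
  obtain A r where r: "r \<in> lin_span M {T h + 1..T n} z"
    and n: "AE \<omega> in M. x (T n) \<omega> = A *v x (T h) \<omega> + r \<omega>"
    using step by auto
  let ?G = "G (T (Suc n)) (T n)"
  have "AE \<omega> in M. x (T (Suc n)) \<omega> = ?G *v x (T n) \<omega> + z (T (Suc n)) \<omega>"
    using waypoint[of "Suc n"] step.prems less by (simp add: z_eq)
  with n have "AE \<omega> in M. x (T (Suc n)) \<omega> = (?G ** A) *v x (T h) \<omega> + (?G *v r \<omega> + z (T (Suc n)) \<omega>)"
    by eventually_elim (simp add: matrix_vector_right_distrib matrix_vector_mul_assoc)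
  moreover have "(\<lambda>\<omega>. ?G *v r \<omega> + z (T (Suc n)) \<omega>) \<in> lin_span M {T h + 1..T (Suc n)} z"
  proof (intro lin_span_add lin_span_matrix)
    show "r \<in> lin_span M {T h + 1..T (Suc n)} z"
      using r by (rule z_mono) (use less TN in auto)
    show "z (T (Suc n)) \<in> lin_span M {T h + 1..T (Suc n)} z"
      using less TN hn by (intro z_base) auto
  qed
  ultimately show ?case by blast
qed

lemma waypoint_CM: "waypoint_CM M m T x"
  unfolding waypoint_CM_def
proof (intro conjI ballI allI impI)
  fix n j k c
  assume n: "n \<in> {1..m}" and jk: "T (n - 1) \<le> j \<and> j < k \<and> k < T n"
  have TN: "T n \<le> N" and less: "T (n - 1) < T n" using n by (auto intro: T_le_N T_less)
  obtain A B r where r: "r \<in> lin_span M {j + 1..k} z"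
    and k: "AE \<omega> in M. x k \<omega> = A *v x j \<omega> + B *v x (T n) \<omega> + r \<omega>"
    using iterate_within_section[OF n, of j k] jk by auto
  let ?I = "{0..j} \<union> {T n}"
  have upto: "x i \<in> lin_span M {0..T (n - 1)} z" if "i \<le> T (n - 1)" for i
    using n that by (intro spans_upto_waypoint) auto
  note in_section = spans_within_section[OF n upto[OF order_refl]]
  have past: "x i \<in> lin_span M ?I z" if "i \<in> ?I" for i
  proof -
    have "i \<le> j \<or> i = T n" using that by auto
    then consider "i \<le> T (n - 1)" | "T (n - 1) \<le> i" "i \<le> j" | "i = T n" by linarith
    then show ?thesis
    proof cases
      case 1
      from upto[OF this] show ?thesis by (rule z_mono) (use jk TN in auto)
    next
      case 2
      with in_section(2)[of i] jk have "x i \<in> lin_span M ({0..i} \<union> {T n}) z" by simp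
      then show ?thesis by (rule z_mono) (use 2 jk TN in auto)
    next
      case 3
      show ?thesis unfolding 3 using in_section(1) by (rule z_mono) (use jk TN in auto)
    qed
  qed
  show "AE \<omega> in M. cond_cdf M (x k) ?I x c \<omega> = cond_cdf M (x k) {j, T n} x c \<omega>"
  proof (rule cond_cdf_eq_if_regression)
    show "x i \<in> V" if "i \<in> ?I" for i using that jk TN by (intro x_in_V) auto
    show "r \<in> V" using r by (rule lin_span_trans) (use jk TN in \<open>auto intro: z_in_V\<close>)
    show "x k \<in> borel_measurable M" using jk TN by (intro x_measurable) auto
    \<comment> \<open>Since \<open>j < T n\<close>, the two indices differ and the conditional picks
      the right matrix for each.\<close>
    show "AE \<omega> in M. x k \<omega> = (\<Sum>i\<in>{j, T n}. (if i = j then A else B) *v x i \<omega>) + r \<omega>"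
      using k jk by simp
    \<comment> \<open>The remainder uses the times from \<open>j + 1\<close> to \<open>k\<close>,
      the conditioning variables those up to \<open>j\<close> and \<open>T n\<close>; these sets are
      disjoint because \<open>k < T n\<close>.\<close>
    show "uncorrelated M r (x i)" if "i \<in> ?I" for i
      using r past[OF that] by (rule z_spans_uncorrelated[rotated 3]) (use jk TN in auto)
  qed auto
next
  fix n h c
  assume n: "n \<in> {1..m}" and h: "h < n"
  have TN: "T n \<le> N" and less: "T h < T n" using n h by (auto intro: T_le_N T_less)
  obtain A r where r: "r \<in> lin_span M {T h + 1..T n} z"
    and Tn: "AE \<omega> in M. x (T n) \<omega> = A *v x (T h) \<omega> + r \<omega>"
    using iterate_waypoints[of h n] n h by auto
  show "AE \<omega> in M. cond_cdf M (x (T n)) {0..T h} x c \<omega> = cond_cdf M (x (T n)) {T h} x c \<omega>"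
  proof (rule cond_cdf_eq_if_regression)
    show "x i \<in> V" if "i \<in> {0..T h}" for i using that less TN by (intro x_in_V) auto
    show "r \<in> V" using r by (rule lin_span_trans) (use TN in \<open>auto intro: z_in_V\<close>)
    show "x (T n) \<in> borel_measurable M" using TN by (intro x_measurable) auto
    show "AE \<omega> in M. x (T n) \<omega> = (\<Sum>i\<in>{T h}. A *v x i \<omega>) + r \<omega>"
      using Tn by simp
    show "uncorrelated M r (x i)" if "i \<in> {0..T h}" for i
    proof (rule z_spans_uncorrelated[OF _ _ _ r])
      show "x i \<in> lin_span M {0..T h} z" using n h that by (intro spans_upto_waypoint) auto
    qed (use less TN in auto)
  qed auto
qed

end

theorem theorem2p9:
  fixes M :: "'a measure"
    and x :: "nat \<Rightarrow> 'a \<Rightarrow> real ^ 'd"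
    and T :: "nat \<Rightarrow> nat"
    and m N :: nat
  assumes "prob_space M"
    and "1 \<le> m" and "T 0 = 0" and "strict_mono_on {0..m} T" and "T m = N"
    and "zero_mean_nonsingular_gaussian M N x"
  shows "waypoint_CM M m T x \<longleftrightarrow>
    (\<exists>(G :: nat \<Rightarrow> nat \<Rightarrow> real ^ 'd ^ 'd) (e :: nat \<Rightarrow> 'a \<Rightarrow> real ^ 'd).
       (\<forall>n\<in>{1..m}. \<forall>k\<in>{T (n - 1) + 1..T n - 1}.
          AE \<omega> in M. x k \<omega> = G k (k - 1) *v x (k - 1) \<omega> + G k (T n) *v x (T n) \<omega> + e k \<omega>) \<and>
       (\<forall>n\<in>{1..m}.
          AE \<omega> in M. x (T n) \<omega> = G (T n) (T (n - 1)) *v x (T (n - 1)) \<omega> + e (T n) \<omega>) \<and>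
       zero_mean_white_gaussian M {1..N} e \<and>
       (\<forall>k\<in>{1..N}. invertible (Cov M (e k) (e k))) \<and>
       jointly_gaussian M {0..N} (e(0 := x 0)) \<and>
       (\<forall>k\<in>{1..N}. Cov M (e k) (x 0) = 0) \<and>
       invertible (Cov M (x 0) (x 0)))"
    (is "_ \<longleftrightarrow> ?model")
proof -
  interpret prob_space M by fact
  interpret gaussian_waypoints T m N M x
    using assms(3-6) by unfold_locales (auto simp: zero_mean_nonsingular_gaussian_def)
  show ?thesis
  proof
    assume "waypoint_CM M m T x"
    then show ?model
    proof (rule representation_if_waypoint_CM)
      fix G e
      assume *: "\<And>n k. n \<in> {1..m} \<Longrightarrow> k \<in> {T (n - 1) + 1..T n - 1} \<Longrightarrow>
          AE \<omega> in M. x k \<omega> = G k (k - 1) *v x (k - 1) \<omega> + G k (T n) *v x (T n) \<omega> + e k \<omega>"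
        "\<And>n. n \<in> {1..m} \<Longrightarrow>
          AE \<omega> in M. x (T n) \<omega> = G (T n) (T (n - 1)) *v x (T (n - 1)) \<omega> + e (T n) \<omega>"
        "zero_mean_white_gaussian M {1..N} e"
        "\<And>k. k \<in> {1..N} \<Longrightarrow> invertible (Cov M (e k) (e k))"
        "jointly_gaussian M {0..N} (e(0 := x 0))"
        "\<And>k. k \<in> {1..N} \<Longrightarrow> Cov M (e k) (x 0) = 0"
      \<comment> \<open>With an empty set of regressors the residual is \<open>x 0\<close>
        itself.\<close>
      have "invertible (Cov M (x 0) (x 0))"
        by (rule invertible_Cov_residual[of 0 "{}"]) auto
      with * show ?model by (intro exI[of _ G] exI[of _ e] conjI ballI)
    qed
  next
    assume ?model
    then obtain G e where "gaussian_waypoints_model T m N M x G e"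
      unfolding gaussian_waypoints_model_def gaussian_waypoints_model_axioms_def
      using gaussian_waypoints_axioms by blast
    then show "waypoint_CM M m T x" by (rule gaussian_waypoints_model.waypoint_CM)
  qed
qed

end
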